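(* Let $f:\mathbb{F}_q^n\times\mathbb{F}_q^n\to\mathbb{F}_q^n$ be a random algebra, and let $g:\mathbb{F}_q^n\times\mathbb{F}_q^n\to\mathbb{F}_q^n$ be an arbitrary algebra. There exists a deterministic algorithm that decides whether $f$ and $g$ are isomorphic in time $q^{O(n)}$, correctly for all but at most a $\frac{1}{q^{\Omega(n)}}$ fraction of $f$.
   Context: An algebra on $V=\mathbb{F}_q^n$ is a bilinear map $*:V\times V\to V$ (no unitality, associativity or commutativity assumed). It is represented by its structure constants $(\alpha_{i,j,k})$ defined by $e_i*e_j=\sum_{k}\alpha_{i,j,k}e_k$; a random algebra has all $\alpha_{i,j,k}$ independent and uniform in $\mathbb{F}_q$. Two algebras $*,\cdot$ on $V$ are isomorphic if there is $T\in\mathrm{GL}(V)$ with $T(u)*T(v)=T(u\cdot v)$ for all $u,v\in V$. *)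

theory Defs
  imports "HOL-Algebra.Ring" "HOL-Library.FuncSet" "HOL-Library.Landau_Symbols"
begin

section \<open>Algebras on the coordinate space of dimension n over a finite field\<close>

text \<open>
  The field, its size \<open>q\<close> and the dimension \<open>n\<close> all vary below the quantifier over algorithms, so
  fields are carrier-based. Every finite field with \<open>q\<close> elements is isomorphic to one with carrier
  \<open>{..<q}\<close>; the labelling of the elements is left arbitrary, in particular \<open>\<zero>\<close> and \<open>\<one>\<close> may
  carry any labels.
\<close>

definition finite_field :: "nat ring \<Rightarrow> nat \<Rightarrow> bool" where
  "finite_field R q \<longleftrightarrow> field R \<and> carrier R = {..<q}"

definition vecs :: "('a, 'm) ring_scheme \<Rightarrow> nat \<Rightarrow> (nat \<Rightarrow> 'a) set" where
  "vecs R n = {..<n} \<rightarrow>\<^sub>E carrier R"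

definition vadd :: "('a, 'm) ring_scheme \<Rightarrow> nat \<Rightarrow> (nat \<Rightarrow> 'a) \<Rightarrow> (nat \<Rightarrow> 'a) \<Rightarrow> (nat \<Rightarrow> 'a)" where
  "vadd R n u v = (\<lambda>i\<in>{..<n}. u i \<oplus>\<^bsub>R\<^esub> v i)"

definition vscale :: "('a, 'm) ring_scheme \<Rightarrow> nat \<Rightarrow> 'a \<Rightarrow> (nat \<Rightarrow> 'a) \<Rightarrow> (nat \<Rightarrow> 'a)" where
  "vscale R n a v = (\<lambda>i\<in>{..<n}. a \<otimes>\<^bsub>R\<^esub> v i)"

definition unit_vec :: "('a, 'm) ring_scheme \<Rightarrow> nat \<Rightarrow> nat \<Rightarrow> (nat \<Rightarrow> 'a)" where
  "unit_vec R n i = (\<lambda>j\<in>{..<n}. if j = i then \<one>\<^bsub>R\<^esub> else \<zero>\<^bsub>R\<^esub>)"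

definition linear_on_vecs ::
  "('a, 'm) ring_scheme \<Rightarrow> nat \<Rightarrow> ((nat \<Rightarrow> 'a) \<Rightarrow> (nat \<Rightarrow> 'a)) \<Rightarrow> bool" where
  "linear_on_vecs R n T \<longleftrightarrow>
     T \<in> vecs R n \<rightarrow> vecs R n \<and>
     (\<forall>u\<in>vecs R n. \<forall>v\<in>vecs R n. T (vadd R n u v) = vadd R n (T u) (T v)) \<and>
     (\<forall>a\<in>carrier R. \<forall>u\<in>vecs R n. T (vscale R n a u) = vscale R n a (T u))"

definition GL :: "('a, 'm) ring_scheme \<Rightarrow> nat \<Rightarrow> ((nat \<Rightarrow> 'a) \<Rightarrow> (nat \<Rightarrow> 'a)) set" where
  "GL R n = {T. linear_on_vecs R n T \<and> bij_betw T (vecs R n) (vecs R n)}"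

text \<open>Extensionality makes each bilinear map a single HOL function, so that algebras can be counted.\<close>

definition algebras ::
  "('a, 'm) ring_scheme \<Rightarrow> nat \<Rightarrow> ((nat \<Rightarrow> 'a) \<Rightarrow> (nat \<Rightarrow> 'a) \<Rightarrow> (nat \<Rightarrow> 'a)) set" where
  "algebras R n =
     {f \<in> vecs R n \<rightarrow>\<^sub>E (vecs R n \<rightarrow>\<^sub>E vecs R n).
        (\<forall>u\<in>vecs R n. linear_on_vecs R n (f u)) \<and>
        (\<forall>v\<in>vecs R n. linear_on_vecs R n (\<lambda>u. f u v))}"

text \<open>The coefficient of \<open>e\<^sub>k\<close> in the product of \<open>e\<^sub>i\<close> and \<open>e\<^sub>j\<close> is its \<open>k\<close>-th coordinate.\<close>

definition struct_const ::
  "('a, 'm) ring_scheme \<Rightarrow> nat \<Rightarrow> ((nat \<Rightarrow> 'a) \<Rightarrow> (nat \<Rightarrow> 'a) \<Rightarrow> (nat \<Rightarrow> 'a)) \<Rightarrow>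
     nat \<times> nat \<times> nat \<Rightarrow> 'a" where
  "struct_const R n f =
     (\<lambda>(i, j, k) \<in> {..<n} \<times> {..<n} \<times> {..<n}. f (unit_vec R n i) (unit_vec R n j) k)"

definition alg_isomorphic ::
  "('a, 'm) ring_scheme \<Rightarrow> nat \<Rightarrow>
     ((nat \<Rightarrow> 'a) \<Rightarrow> (nat \<Rightarrow> 'a) \<Rightarrow> (nat \<Rightarrow> 'a)) \<Rightarrow>
     ((nat \<Rightarrow> 'a) \<Rightarrow> (nat \<Rightarrow> 'a) \<Rightarrow> (nat \<Rightarrow> 'a)) \<Rightarrow> bool" where
  "alg_isomorphic R n f g \<longleftrightarrow>
     (\<exists>T\<in>GL R n. \<forall>u\<in>vecs R n. \<forall>v\<in>vecs R n. f (T u) (T v) = T (g u v))"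


subsection \<open>Algebras correspond to arbitrary tables of structure constants\<close>

text \<open>
  Hence choosing all structure constants independently and uniformly is the uniform distribution on
  \<^const>\<open>algebras\<close>, and the fraction of a set of algebras is its probability.
\<close>

lemma vecs_memD: "u \<in> vecs R n \<Longrightarrow> i < n \<Longrightarrow> u i \<in> carrier R"
  by (auto simp: vecs_def PiE_def Pi_def)

lemma vecs_eqI:
  assumes "u \<in> vecs R n" "v \<in> vecs R n" "\<And>i. i < n \<Longrightarrow> u i = v i"
  shows "u = v"
  using assms unfolding vecs_def by (intro PiE_ext) auto

context ring
begin

lemma vadd_closed: "u \<in> vecs R n \<Longrightarrow> v \<in> vecs R n \<Longrightarrow> vadd R n u v \<in> vecs R n"
  unfolding vecs_def vadd_def by (auto simp: PiE_def Pi_def)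

lemma vscale_closed: "a \<in> carrier R \<Longrightarrow> v \<in> vecs R n \<Longrightarrow> vscale R n a v \<in> vecs R n"
  unfolding vecs_def vscale_def by (auto simp: PiE_def Pi_def)

lemma unit_vec_closed: "unit_vec R n i \<in> vecs R n"
  unfolding vecs_def unit_vec_def by auto

lemma linear_on_vecs_eqI:
  assumes S: "linear_on_vecs R n S" and T: "linear_on_vecs R n T"
    and eq: "\<And>i. i < n \<Longrightarrow> S (unit_vec R n i) = T (unit_vec R n i)"
    and u: "u \<in> vecs R n"
  shows "S u = T u"
proof -
  define w where "w m = (\<lambda>i\<in>{..<n}. if i < m then u i else \<zero>)" for m
  have wV: "w m \<in> vecs R n" for m
    unfolding w_def vecs_def using vecs_memD[OF u] by auto
  have "m \<le> n \<Longrightarrow> S (w m) = T (w m)" for m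
  proof (induction m)
    case 0
    have z: "vscale R n \<zero> x = w 0" if "x \<in> vecs R n" for x
      unfolding vscale_def w_def using vecs_memD[OF that] by (auto intro!: restrict_ext)
    have "L (w 0) = w 0" if L: "linear_on_vecs R n L" for L
    proof -
      have "L (w 0) = L (vscale R n \<zero> (w 0))" using z[OF wV] by simp
      also have "\<dots> = vscale R n \<zero> (L (w 0))" using L wV unfolding linear_on_vecs_def by blast
      also have "\<dots> = w 0" using L wV unfolding linear_on_vecs_def by (intro z) auto
      finally show ?thesis .
    qed
    with S T show ?case by simp
  next
    case (Suc m)
    then have m: "m < n" by simp
    note um = vecs_memD[OF u m]
    let ?x = "vscale R n (u m) (unit_vec R n m)"
    have xV: "?x \<in> vecs R n" using um unit_vec_closed by (rule vscale_closed)
    have split: "w (Suc m) = vadd R n (w m) ?x"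
    proof (rule vecs_eqI[OF wV vadd_closed[OF wV xV]])
      fix i assume "i < n"
      then show "w (Suc m) i = vadd R n (w m) ?x i"
        using vecs_memD[OF u, of i] um
        by (auto simp: w_def vadd_def vscale_def unit_vec_def less_Suc_eq)
    qed
    have "L (w (Suc m)) = vadd R n (L (w m)) (vscale R n (u m) (L (unit_vec R n m)))"
      if "linear_on_vecs R n L" for L
      using that wV xV um unit_vec_closed unfolding split linear_on_vecs_def by simp
    then show ?case using S T Suc eq[OF m] by simp
  qed
  moreover have "w n = u"
    by (rule vecs_eqI[OF wV u]) (simp add: w_def)
  ultimately show ?thesis by fastforce
qed

end

context cring
begin

lemma finsum_unit_vec:
  assumes "i < n" "\<And>j. j < n \<Longrightarrow> h j \<in> carrier R"
  shows "(\<Oplus>j\<in>{..<n}. unit_vec R n i j \<otimes> h j) = h i"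
proof -
  have "(\<Oplus>j\<in>{..<n}. unit_vec R n i j \<otimes> h j) = (\<Oplus>j\<in>{..<n}. if i = j then h j else \<zero>)"
    using assms by (intro finsum_cong') (auto simp: unit_vec_def)
  also have "\<dots> = h i"
    using assms by (intro finsum_singleton) auto
  finally show ?thesis .
qed

lemma finsum_vadd:
  assumes "u \<in> vecs R n" "w \<in> vecs R n" "\<And>i. i < n \<Longrightarrow> h i \<in> carrier R"
  shows "(\<Oplus>i\<in>{..<n}. vadd R n u w i \<otimes> h i) = (\<Oplus>i\<in>{..<n}. u i \<otimes> h i) \<oplus> (\<Oplus>i\<in>{..<n}. w i \<otimes> h i)"
proof -
  note m = vecs_memD[OF assms(1)] vecs_memD[OF assms(2)] assms(3)
  have "(\<Oplus>i\<in>{..<n}. vadd R n u w i \<otimes> h i) = (\<Oplus>i\<in>{..<n}. u i \<otimes> h i \<oplus> w i \<otimes> h i)"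
    by (rule finsum_cong') (simp_all add: m vadd_def l_distr Pi_def)
  also have "\<dots> = (\<Oplus>i\<in>{..<n}. u i \<otimes> h i) \<oplus> (\<Oplus>i\<in>{..<n}. w i \<otimes> h i)"
    by (rule finsum_addf) (simp_all add: m Pi_def)
  finally show ?thesis .
qed

lemma finsum_vscale:
  assumes "a \<in> carrier R" "u \<in> vecs R n" "\<And>i. i < n \<Longrightarrow> h i \<in> carrier R"
  shows "(\<Oplus>i\<in>{..<n}. vscale R n a u i \<otimes> h i) = a \<otimes> (\<Oplus>i\<in>{..<n}. u i \<otimes> h i)"
proof -
  note m = vecs_memD[OF assms(2)] assms(1,3)
  have "(\<Oplus>i\<in>{..<n}. vscale R n a u i \<otimes> h i) = (\<Oplus>i\<in>{..<n}. a \<otimes> (u i \<otimes> h i))"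
    by (rule finsum_cong') (simp_all add: m vscale_def m_assoc Pi_def)
  also have "\<dots> = a \<otimes> (\<Oplus>i\<in>{..<n}. u i \<otimes> h i)"
    by (rule finsum_rdistr[symmetric]) (simp_all add: m Pi_def)
  finally show ?thesis .
qed

lemma bij_betw_struct_const:
  "bij_betw (struct_const R n) (algebras R n) ({..<n} \<times> {..<n} \<times> {..<n} \<rightarrow>\<^sub>E carrier R)"
proof (rule bij_betw_imageI)
  show "inj_on (struct_const R n) (algebras R n)"
  proof (rule inj_onI)
    fix f g assume f: "f \<in> algebras R n" and g: "g \<in> algebras R n"
      and eq: "struct_const R n f = struct_const R n g"
    have V: "h u v \<in> vecs R n" if "h \<in> algebras R n" "u \<in> vecs R n" "v \<in> vecs R n" for h u v
      using that unfolding algebras_def linear_on_vecs_def by blast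
    have basis: "f (unit_vec R n i) (unit_vec R n j) = g (unit_vec R n i) (unit_vec R n j)"
      if "i < n" "j < n" for i j
    proof (rule vecs_eqI[of _ R n])
      fix k assume "k < n"
      then show "f (unit_vec R n i) (unit_vec R n j) k = g (unit_vec R n i) (unit_vec R n j) k"
        using fun_cong[OF eq, of "(i, j, k)"] that by (simp add: struct_const_def)
    qed (use V f g unit_vec_closed in auto)
    have L: "linear_on_vecs R n (h u)" "linear_on_vecs R n (\<lambda>w. h w u)"
      if "h \<in> algebras R n" "u \<in> vecs R n" for h u
      using that unfolding algebras_def by auto
    have left: "f (unit_vec R n i) v = g (unit_vec R n i) v" if "i < n" "v \<in> vecs R n" for i v
      by (rule linear_on_vecs_eqI[of n "f (unit_vec R n i)" "g (unit_vec R n i)"])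
        (use L f g unit_vec_closed basis that in auto)
    have all: "f u v = g u v" if "u \<in> vecs R n" "v \<in> vecs R n" for u v
      by (rule linear_on_vecs_eqI[of n "\<lambda>u. f u v" "\<lambda>u. g u v"])
        (use L f g left that in auto)
    have fE: "f \<in> vecs R n \<rightarrow>\<^sub>E (vecs R n \<rightarrow>\<^sub>E vecs R n)"
      and gE: "g \<in> vecs R n \<rightarrow>\<^sub>E (vecs R n \<rightarrow>\<^sub>E vecs R n)"
      using f g unfolding algebras_def by auto
    show "f = g"
    proof (rule PiE_ext[OF fE gE])
      fix u assume u: "u \<in> vecs R n"
      show "f u = g u"
        by (rule PiE_ext[OF PiE_mem[OF fE u] PiE_mem[OF gE u]]) (use all u in auto)
    qed
  qed
next
  let ?C = "{..<n} \<times> {..<n} \<times> {..<n} \<rightarrow>\<^sub>E carrier R"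
  have "struct_const R n f \<in> ?C" if "f \<in> algebras R n" for f
  proof -
    have "f (unit_vec R n i) (unit_vec R n j) \<in> vecs R n" for i j
      using that unit_vec_closed unfolding algebras_def linear_on_vecs_def by blast
    then show ?thesis
      unfolding struct_const_def by (auto intro: vecs_memD)
  qed
  moreover have "c \<in> struct_const R n ` algebras R n" if c: "c \<in> ?C" for c
  proof -
    define p where "p u v = (\<lambda>k\<in>{..<n}. \<Oplus>i\<in>{..<n}. u i \<otimes> (\<Oplus>j\<in>{..<n}. v j \<otimes> c (i, j, k)))" for u v
    define f where "f = (\<lambda>u\<in>vecs R n. \<lambda>v\<in>vecs R n. p u v)"
    have cC: "c (i, j, k) \<in> carrier R" if "i < n" "j < n" "k < n" for i j k
      using c that by (auto simp: PiE_def Pi_def)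
    have inner: "(\<Oplus>j\<in>{..<n}. v j \<otimes> c (i, j, k)) \<in> carrier R"
      if "v \<in> vecs R n" "i < n" "k < n" for v i k
      using that cC vecs_memD[OF that(1)] by (intro finsum_closed) auto
    have pV: "p u v \<in> vecs R n" if "u \<in> vecs R n" "v \<in> vecs R n" for u v
      unfolding p_def vecs_def
      using that inner[OF that(2)] vecs_memD[OF that(1)]
      by (auto intro!: finsum_closed)
    have p_nth: "p u v k = (\<Oplus>i\<in>{..<n}. u i \<otimes> (\<Oplus>j\<in>{..<n}. v j \<otimes> c (i, j, k)))"
      if "k < n" for u v k
      using that by (simp add: p_def)
    have p_add1: "p (vadd R n u w) v = vadd R n (p u v) (p w v)"
      if "u \<in> vecs R n" "w \<in> vecs R n" "v \<in> vecs R n" for u w v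
    proof (rule vecs_eqI[of _ R n])
      fix k assume k: "k < n"
      show "p (vadd R n u w) v k = vadd R n (p u v) (p w v) k"
        using finsum_vadd[OF that(1,2) inner[OF that(3) _ k]] k by (simp add: p_nth vadd_def)
    qed (use that pV vadd_closed in auto)
    have p_scale1: "p (vscale R n a u) v = vscale R n a (p u v)"
      if "a \<in> carrier R" "u \<in> vecs R n" "v \<in> vecs R n" for a u v
    proof (rule vecs_eqI[of _ R n])
      fix k assume k: "k < n"
      show "p (vscale R n a u) v k = vscale R n a (p u v) k"
        using finsum_vscale[OF that(1,2) inner[OF that(3) _ k]] k by (simp add: p_nth vscale_def)
    qed (use that pV vscale_closed in auto)
    have p_add2: "p u (vadd R n v w) = vadd R n (p u v) (p u w)"
      if "u \<in> vecs R n" "v \<in> vecs R n" "w \<in> vecs R n" for u v w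
    proof (rule vecs_eqI[of _ R n])
      fix k assume k: "k < n"
      note m = vecs_memD[OF that(1)] inner[OF that(2) _ k] inner[OF that(3) _ k]
      have "p u (vadd R n v w) k =
          (\<Oplus>i\<in>{..<n}. u i \<otimes> (\<Oplus>j\<in>{..<n}. v j \<otimes> c (i, j, k)) \<oplus> u i \<otimes> (\<Oplus>j\<in>{..<n}. w j \<otimes> c (i, j, k)))"
        unfolding p_nth[OF k]
        by (rule finsum_cong') (simp_all add: m finsum_vadd[OF that(2,3)] cC k r_distr Pi_def)
      also have "\<dots> = p u v k \<oplus> p u w k"
        unfolding p_nth[OF k] by (rule finsum_addf) (simp_all add: m Pi_def)
      finally show "p u (vadd R n v w) k = vadd R n (p u v) (p u w) k"
        using k by (simp add: vadd_def)
    qed (use that pV vadd_closed in auto)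
    have p_scale2: "p u (vscale R n a v) = vscale R n a (p u v)"
      if a: "a \<in> carrier R" and "u \<in> vecs R n" "v \<in> vecs R n" for a u v
    proof (rule vecs_eqI[of _ R n])
      fix k assume k: "k < n"
      note m = vecs_memD[OF that(2)] inner[OF that(3) _ k] a
      have "p u (vscale R n a v) k =
          (\<Oplus>i\<in>{..<n}. a \<otimes> (u i \<otimes> (\<Oplus>j\<in>{..<n}. v j \<otimes> c (i, j, k))))"
        unfolding p_nth[OF k]
        by (rule finsum_cong') (simp_all add: m finsum_vscale[OF a that(3)] cC k m_lcomm Pi_def)
      also have "\<dots> = a \<otimes> p u v k"
        unfolding p_nth[OF k] by (rule finsum_rdistr[symmetric]) (simp_all add: m Pi_def)
      finally show "p u (vscale R n a v) k = vscale R n a (p u v) k"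
        using k by (simp add: vscale_def)
    qed (use that pV vscale_closed in auto)
    have "f \<in> vecs R n \<rightarrow>\<^sub>E (vecs R n \<rightarrow>\<^sub>E vecs R n)"
      unfolding f_def using pV by auto
    then have "f \<in> algebras R n"
      using pV p_add1 p_add2 p_scale1 p_scale2 vadd_closed vscale_closed
      unfolding algebras_def linear_on_vecs_def by (simp add: f_def Pi_def)
    moreover have "struct_const R n f = c"
    proof (rule PiE_ext[OF _ c])
      show "struct_const R n f \<in> ?C"
        using pV[OF unit_vec_closed unit_vec_closed] unit_vec_closed
        unfolding struct_const_def by (auto simp: f_def intro: vecs_memD)
      fix x assume "x \<in> {..<n} \<times> {..<n} \<times> {..<n}"
      then obtain i j k where x: "x = (i, j, k)" and ijk: "i < n" "j < n" "k < n" by auto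
      have "struct_const R n f x = p (unit_vec R n i) (unit_vec R n j) k"
        using x ijk unit_vec_closed by (simp add: struct_const_def f_def)
      also have "\<dots> = (\<Oplus>j'\<in>{..<n}. unit_vec R n j j' \<otimes> c (i, j', k))"
        unfolding p_nth[OF ijk(3)]
        by (rule finsum_unit_vec) (use ijk inner unit_vec_closed in auto)
      also have "\<dots> = c x"
        using ijk cC x by (simp add: finsum_unit_vec)
      finally show "struct_const R n f x = c x" .
    qed
    ultimately show ?thesis by blast
  qed
  ultimately show "struct_const R n ` algebras R n = ?C" by blast
qed

end


section \<open>Deterministic algorithms and running time\<close>

text \<open>
  Programs of a random access machine with finitely many registers and finitely many memory banks,
  each cell holding a natural number, in structured form. Every operation has unit cost. The only
  arithmetic is addition and truncated subtraction, so after \<open>t\<close> steps all numbers have at most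
  \<open>t\<close> bits more than the numbers in the input and the program; running times are therefore
  polynomially related to those of Turing machines, and a bound of the form
  \<open>q\<close> to the power \<open>O(n)\<close> means the same in both models.
\<close>

type_synonym state = "(nat \<Rightarrow> nat) \<times> (nat \<Rightarrow> nat \<Rightarrow> nat)"

datatype expr =
    Const nat
  | Reg nat
  | Mem nat expr
  | Plus expr expr
  | Minus expr expr

primrec val :: "expr \<Rightarrow> state \<Rightarrow> nat" where
  "val (Const k) \<sigma> = k"
| "val (Reg x) \<sigma> = fst \<sigma> x"
| "val (Mem b e) \<sigma> = snd \<sigma> b (val e \<sigma>)"
| "val (Plus d e) \<sigma> = val d \<sigma> + val e \<sigma>"
| "val (Minus d e) \<sigma> = val d \<sigma> - val e \<sigma>"

primrec cost :: "expr \<Rightarrow> nat" where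
  "cost (Const k) = 1"
| "cost (Reg x) = 1"
| "cost (Mem b e) = 1 + cost e"
| "cost (Plus d e) = 1 + cost d + cost e"
| "cost (Minus d e) = 1 + cost d + cost e"

datatype prog =
    Skip
  | Assign nat expr
  | Store nat expr expr
  | Seq prog prog
  | Cond expr prog prog
  | While expr prog

text \<open>
  \<open>exec P \<sigma> t \<tau>\<close>: started in \<open>\<sigma>\<close>, the program \<open>P\<close> halts in \<open>\<tau>\<close> after exactly \<open>t\<close> steps.
  \<open>Store b d e\<close> writes the value of \<open>e\<close> to address \<open>d\<close> of bank \<open>b\<close>. A condition holds iff its
  value is nonzero.
\<close>

inductive exec :: "prog \<Rightarrow> state \<Rightarrow> nat \<Rightarrow> state \<Rightarrow> bool" where
  Skip: "exec Skip \<sigma> 1 \<sigma>"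
| Assign: "exec (Assign x e) \<sigma> (1 + cost e) ((fst \<sigma>)(x := val e \<sigma>), snd \<sigma>)"
| Store: "exec (Store b d e) \<sigma> (1 + cost d + cost e)
    (fst \<sigma>, (snd \<sigma>)(b := (snd \<sigma> b)(val d \<sigma> := val e \<sigma>)))"
| Seq: "exec P \<sigma> s \<rho> \<Longrightarrow> exec Q \<rho> t \<tau> \<Longrightarrow> exec (Seq P Q) \<sigma> (s + t) \<tau>"
| Cond_true: "val e \<sigma> \<noteq> 0 \<Longrightarrow> exec P \<sigma> t \<tau> \<Longrightarrow> exec (Cond e P Q) \<sigma> (1 + cost e + t) \<tau>"
| Cond_false: "val e \<sigma> = 0 \<Longrightarrow> exec Q \<sigma> t \<tau> \<Longrightarrow> exec (Cond e P Q) \<sigma> (1 + cost e + t) \<tau>"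
| While_true: "val e \<sigma> \<noteq> 0 \<Longrightarrow> exec P \<sigma> s \<rho> \<Longrightarrow> exec (While e P) \<rho> t \<tau> \<Longrightarrow>
    exec (While e P) \<sigma> (1 + cost e + s + t) \<tau>"
| While_false: "val e \<sigma> = 0 \<Longrightarrow> exec (While e P) \<sigma> (1 + cost e) \<sigma>"

inductive_cases Skip_execE: "exec Skip \<sigma> t \<tau>"
inductive_cases Assign_execE: "exec (Assign x e) \<sigma> t \<tau>"
inductive_cases Store_execE: "exec (Store b d e) \<sigma> t \<tau>"
inductive_cases Seq_execE: "exec (Seq P Q) \<sigma> t \<tau>"
inductive_cases Cond_execE: "exec (Cond e P Q) \<sigma> t \<tau>"
inductive_cases While_execE: "exec (While e P) \<sigma> t \<tau>"

lemma exec_deterministic: "exec P \<sigma> s \<rho> \<Longrightarrow> exec P \<sigma> t \<tau> \<Longrightarrow> t = s \<and> \<tau> = \<rho>"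
proof (induction arbitrary: t \<tau> rule: exec.induct)
  case (Skip \<sigma>)
  then show ?case by (auto elim: Skip_execE)
next
  case (Assign x e \<sigma>)
  then show ?case by (auto elim: Assign_execE)
next
  case (Store b d e \<sigma>)
  then show ?case by (auto elim: Store_execE)
next
  case (Seq P \<sigma> s \<rho> Q t' \<tau>')
  from Seq.prems obtain s1 t1 \<rho>1
    where "t = s1 + t1" "exec P \<sigma> s1 \<rho>1" "exec Q \<rho>1 t1 \<tau>" by (rule Seq_execE)
  with Seq.IH show ?case by metis
next
  case (Cond_true e \<sigma> P t' \<tau>' Q)
  from Cond_true.prems Cond_true.hyps(1) obtain t1
    where "t = 1 + cost e + t1" "exec P \<sigma> t1 \<tau>" by (elim Cond_execE) simp_all
  with Cond_true.IH show ?case by metis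
next
  case (Cond_false e \<sigma> Q t' \<tau>' P)
  from Cond_false.prems Cond_false.hyps(1) obtain t1
    where "t = 1 + cost e + t1" "exec Q \<sigma> t1 \<tau>" by (elim Cond_execE) simp_all
  with Cond_false.IH show ?case by metis
next
  case (While_true e \<sigma> P s \<rho> t' \<tau>')
  from While_true.prems show ?case
  proof (rule While_execE)
    fix s1 \<rho>1 t1
    assume t: "t = Suc (cost e + s1 + t1)"
      and "exec P \<sigma> s1 \<rho>1" "exec (While e P) \<rho>1 t1 \<tau>"
    with While_true.IH have "s1 = s" "t1 = t'" "\<tau> = \<tau>'" by metis+
    with t show ?thesis by simp
  qed (use While_true.hyps(1) in simp)
next
  case (While_false e \<sigma> P)
  from While_false.prems show ?case by (rule While_execE) (use While_false.hyps in simp_all)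
qed

definition halts_within :: "prog \<Rightarrow> state \<Rightarrow> nat \<Rightarrow> bool" where
  "halts_within P \<sigma> T \<longleftrightarrow> (\<exists>t \<tau>. exec P \<sigma> t \<tau> \<and> t \<le> T)"

definition accepts :: "prog \<Rightarrow> state \<Rightarrow> bool" where
  "accepts P \<sigma> \<longleftrightarrow> (\<exists>t \<tau>. exec P \<sigma> t \<tau> \<and> fst \<tau> 0 \<noteq> 0)"

text \<open>
  Input for a pair of algebras: \<open>q\<close> and \<open>n\<close> in registers 0 and 1; in banks 0 to 3, in row-major
  order and with one field element per cell, the addition and multiplication tables of the field
  and the structure constants of the two algebras. All other registers and cells are 0.
\<close>

definition field_table :: "nat \<Rightarrow> (nat \<Rightarrow> nat \<Rightarrow> nat) \<Rightarrow> nat \<Rightarrow> nat" where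
  "field_table q h m = (if m < q * q then h (m div q) (m mod q) else 0)"

definition const_table :: "nat \<Rightarrow> (nat \<times> nat \<times> nat \<Rightarrow> nat) \<Rightarrow> nat \<Rightarrow> nat" where
  "const_table n c m =
     (if m < n * n * n then c (m div (n * n), (m div n) mod n, m mod n) else 0)"

definition input ::
  "nat ring \<Rightarrow> nat \<Rightarrow> nat \<Rightarrow>
     ((nat \<Rightarrow> nat) \<Rightarrow> (nat \<Rightarrow> nat) \<Rightarrow> (nat \<Rightarrow> nat)) \<Rightarrow>
     ((nat \<Rightarrow> nat) \<Rightarrow> (nat \<Rightarrow> nat) \<Rightarrow> (nat \<Rightarrow> nat)) \<Rightarrow> state" where
  "input R q n f g =
     ((\<lambda>_. 0)(0 := q, 1 := n),
      (\<lambda>_ _. 0)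
        (0 := field_table q (\<lambda>a b. a \<oplus>\<^bsub>R\<^esub> b),
         1 := field_table q (\<lambda>a b. a \<otimes>\<^bsub>R\<^esub> b),
         2 := const_table n (struct_const R n f),
         3 := const_table n (struct_const R n g)))"

end

theory Submission
  imports Defs
begin

text \<open>
  The product algebra on pairs of vectors reduces isomorphism to closures: a pair \<open>(x, v)\<close> generates
  a subalgebra of \<open>g \<times> f\<close>, and if this subalgebra is the graph of a bijection then that bijection is
  an isomorphism. Conversely, if a single vector \<open>v\<close> generates \<open>f\<close>, then every isomorphism is the
  subalgebra generated by some \<open>(x, v)\<close>. The algorithm tries all \<open>q\<^bsup>2n\<^esup>\<close> pairs and computes each
  closure by marking a table of pairs.

  For a random \<open>f\<close> the vector \<open>e\<^sub>0\<close> generates: otherwise \<open>f\<close> preserves a proper subspace of some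
  dimension \<open>k\<close> containing \<open>e\<^sub>0\<close>. A given subspace is preserved with probability
  \<open>1 / q\<^bsup>k\<^sup>2(n-k)\<^esup>\<close>, and there are at most \<open>2\<^sup>n q\<^bsup>k(n-k)\<^esup>\<close> subspaces of dimension \<open>k\<close>, which
  suffices for \<open>k \<ge> 2\<close>; for \<open>k = 1\<close> the line through \<open>e\<^sub>0\<close> is the only candidate.
\<close>

section \<open>Weakest preconditions with time bounds\<close>

text \<open>Errors are one-sided: a bijective closure gives an isomorphism for every
  \<open>f\<close>, so only isomorphic pairs can be misjudged. The error set is bounded by a
  property of \<open>f\<close> alone, hence the estimate holds for all \<open>g\<close>
  simultaneously. Lines are the obstacle in the union bound: there are about
  \<open>q ^ (n - 1)\<close> of them, each preserved with probability
  \<open>1 / q ^ (n - 1)\<close>. Fixing the generator in advance leaves one line. For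
  \<open>k \<ge> 2\<close> the surplus exponent \<open>k * (k - 1) * (n - k)\<close> is at least
  \<open>2 * (n - 2)\<close>, which beats the \<open>2 ^ n\<close> choices of coordinate sets
  because \<open>2 \<le> q\<close>. Adding both cases gives \<open>1 / q ^ (n - 5)\<close>. Running
  time is never counted exactly: every loop runs at most \<open>(q + 1) * q ^ n * q ^ n\<close>
  times, and a fixed program is polynomial in such a bound.\<close>

text \<open>
  Bounds the running time of a program provided that no loop is iterated more than \<open>B\<close> times each
  time it is entered.
\<close>

primrec time_bound :: "nat \<Rightarrow> prog \<Rightarrow> nat" where
  "time_bound B Skip = 1"
| "time_bound B (Assign x e) = 1 + cost e"
| "time_bound B (Store b d e) = 1 + cost d + cost e"
| "time_bound B (Seq P Q) = time_bound B P + time_bound B Q"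
| "time_bound B (Cond e P Q) = 1 + cost e + time_bound B P + time_bound B Q"
| "time_bound B (While e P) = (B + 1) * (1 + cost e + time_bound B P)"

text \<open>The exponent depends only on the program text, so one bound of size \<open>q\<close> to
  the power \<open>O(n)\<close> on all loops already yields the running time. Exponents are added
  rather than maximised; the base \<open>B + 1\<close> keeps powers monotone also for
  \<open>B = 0\<close>.\<close>

lemma time_bound_polynomial: "\<exists>C D. \<forall>B. time_bound B P \<le> C * (B + 1) ^ D"
proof (induction P)
  case (Seq P Q)
  then obtain C D C' D' where *: "\<And>B. time_bound B P \<le> C * (B + 1) ^ D"
    "\<And>B. time_bound B Q \<le> C' * (B + 1) ^ D'" by blast
  have "time_bound B (Seq P Q) \<le> (C + C') * (B + 1) ^ (D + D')" for B
  proof -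
    have "time_bound B (Seq P Q) \<le> C * (B + 1) ^ D + C' * (B + 1) ^ D'"
      using *[of B] by simp
    also have "\<dots> \<le> C * (B + 1) ^ (D + D') + C' * (B + 1) ^ (D + D')"
      by (intro add_mono mult_left_mono power_increasing) auto
    finally show ?thesis by (simp add: algebra_simps)
  qed
  then show ?case by blast
next
  case (Cond e P Q)
  then obtain C D C' D' where *: "\<And>B. time_bound B P \<le> C * (B + 1) ^ D"
    "\<And>B. time_bound B Q \<le> C' * (B + 1) ^ D'" by blast
  have "time_bound B (Cond e P Q) \<le> (1 + cost e + C + C') * (B + 1) ^ (D + D')" for B
  proof -
    have "time_bound B (Cond e P Q) \<le> (1 + cost e) * 1 + C * (B + 1) ^ D + C' * (B + 1) ^ D'"
      using *[of B] by simp
    also have "\<dots> \<le> (1 + cost e) * (B + 1) ^ (D + D')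
        + C * (B + 1) ^ (D + D') + C' * (B + 1) ^ (D + D')"
      by (intro add_mono mult_left_mono power_increasing one_le_power) auto
    finally show ?thesis by (simp add: algebra_simps)
  qed
  then show ?case by blast
next
  case (While e P)
  then obtain C D where *: "\<And>B. time_bound B P \<le> C * (B + 1) ^ D" by blast
  have "time_bound B (While e P) \<le> (1 + cost e + C) * (B + 1) ^ Suc D" for B
  proof -
    have "1 + cost e + time_bound B P \<le> (1 + cost e) * 1 + C * (B + 1) ^ D"
      using *[of B] by simp
    also have "\<dots> \<le> (1 + cost e) * (B + 1) ^ D + C * (B + 1) ^ D"
      by (intro add_mono mult_left_mono one_le_power) auto
    finally have "(B + 1) * (1 + cost e + time_bound B P) \<le> (B + 1) * ((1 + cost e + C) * (B + 1) ^ D)"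
      by (intro mult_left_mono) (auto simp: algebra_simps)
    then show ?thesis by (simp add: algebra_simps)
  qed
  then show ?case by blast
next
  case Skip
  show ?case by (intro exI[of _ 1] exI[of _ 0]) simp
next
  case (Assign x e)
  show ?case by (intro exI[of _ "1 + cost e"] exI[of _ 0]) simp
next
  case (Store b d e)
  show ?case by (intro exI[of _ "1 + cost d + cost e"] exI[of _ 0]) simp
qed

section \<open>Frame conditions and total correctness\<close>

primrec written_regs :: "prog \<Rightarrow> nat set" where
  "written_regs Skip = {}"
| "written_regs (Assign x e) = {x}"
| "written_regs (Store b d e) = {}"
| "written_regs (Seq P Q) = written_regs P \<union> written_regs Q"
| "written_regs (Cond e P Q) = written_regs P \<union> written_regs Q"
| "written_regs (While e P) = written_regs P"

primrec written_banks :: "prog \<Rightarrow> nat set" where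
  "written_banks Skip = {}"
| "written_banks (Assign x e) = {}"
| "written_banks (Store b d e) = {b}"
| "written_banks (Seq P Q) = written_banks P \<union> written_banks Q"
| "written_banks (Cond e P Q) = written_banks P \<union> written_banks Q"
| "written_banks (While e P) = written_banks P"

lemma exec_frame:
  "exec P \<sigma> t \<tau> \<Longrightarrow>
    (\<forall>x. x \<notin> written_regs P \<longrightarrow> fst \<tau> x = fst \<sigma> x) \<and>
    (\<forall>b. b \<notin> written_banks P \<longrightarrow> snd \<tau> b = snd \<sigma> b)"
  by (induction rule: exec.induct) auto

text \<open>Stated as existence of a run, which by determinism of \<open>exec\<close> is the only
  one. Registers and banks are separate arguments so that assignments become plain function updates
  for the simplifier.\<close>

definition wp ::
  "nat \<Rightarrow> prog \<Rightarrow> ((nat \<Rightarrow> nat) \<Rightarrow> (nat \<Rightarrow> nat \<Rightarrow> nat) \<Rightarrow> bool) \<Rightarrow> (nat \<Rightarrow> nat) \<Rightarrow> (nat \<Rightarrow> nat \<Rightarrow> nat) \<Rightarrow> bool" where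
  "wp B P Q r m \<longleftrightarrow> (\<exists>t r' m'. exec P (r, m) t (r', m') \<and> t \<le> time_bound B P \<and> Q r' m')"

lemma wp_Skip: "Q r m \<Longrightarrow> wp B Skip Q r m"
  unfolding wp_def using exec.Skip by fastforce

lemma wp_Assign: "Q (r(x := val e (r, m))) m \<Longrightarrow> wp B (Assign x e) Q r m"
  unfolding wp_def using exec.Assign[of x e "(r, m)"] by fastforce

lemma wp_Store:
  "Q r (m(b := (m b)(val d (r, m) := val e (r, m)))) \<Longrightarrow> wp B (Store b d e) Q r m"
  unfolding wp_def using exec.Store[of b d e "(r, m)"] by fastforce

lemma wp_Seq:
  assumes "wp B P (\<lambda>r m. wp B P' Q r m) r m"
  shows "wp B (Seq P P') Q r m"
proof -
  from assms obtain t r' m' t' r'' m''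
    where "exec P (r, m) t (r', m')" "t \<le> time_bound B P"
      "exec P' (r', m') t' (r'', m'')" "t' \<le> time_bound B P'" "Q r'' m''"
    unfolding wp_def by blast
  then show ?thesis
    unfolding wp_def by (intro exI[of _ "t + t'"] exI[of _ r''] exI[of _ m'']) (auto intro: exec.Seq)
qed

lemma wp_Cond:
  assumes "val e (r, m) \<noteq> 0 \<Longrightarrow> wp B P Q r m" "val e (r, m) = 0 \<Longrightarrow> wp B P' Q r m"
  shows "wp B (Cond e P P') Q r m"
proof (cases "val e (r, m) = 0")
  case True
  with assms obtain t r' m' where "exec P' (r, m) t (r', m')" "t \<le> time_bound B P'" "Q r' m'"
    unfolding wp_def by blast
  with True show ?thesis
    unfolding wp_def
    by (intro exI[of _ "1 + cost e + t"] exI[of _ r'] exI[of _ m']) (auto intro: exec.Cond_false[simplified])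
next
  case False
  with assms obtain t r' m' where "exec P (r, m) t (r', m')" "t \<le> time_bound B P" "Q r' m'"
    unfolding wp_def by blast
  with False show ?thesis
    unfolding wp_def
    by (intro exI[of _ "1 + cost e + t"] exI[of _ r'] exI[of _ m']) (auto intro: exec.Cond_true[simplified])
qed

text \<open>A consequence rule that also hands over everything the program cannot have changed, so
  that specifications need to mention only what is written.\<close>

lemma wp_frame:
  assumes "wp B P Q r m"
    and "\<And>r' m'. Q r' m' \<Longrightarrow> \<forall>z. z \<notin> written_regs P \<longrightarrow> r' z = r z \<Longrightarrow>
      \<forall>b. b \<notin> written_banks P \<longrightarrow> m' b = m b \<Longrightarrow> Q' r' m'"
  shows "wp B P Q' r m"
proof -
  obtain t r' m' where *: "exec P (r, m) t (r', m')" "t \<le> time_bound B P" "Q r' m'"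
    using assms(1) unfolding wp_def by blast
  have "Q' r' m'"
    using assms(2)[OF *(3)] exec_frame[OF *(1)] by simp
  with * show ?thesis unfolding wp_def by blast
qed

text \<open>Truncated subtraction makes the loop condition nonzero exactly while the counter in
  \<open>x\<close> is below the limit in \<open>y\<close>.\<close>

definition For :: "nat \<Rightarrow> nat \<Rightarrow> prog \<Rightarrow> prog" where
  "For x y P = Seq (Assign x (Const 0))
     (While (Minus (Reg y) (Reg x)) (Seq P (Assign x (Plus (Reg x) (Const 1)))))"

lemma written_For [simp]:
  "written_regs (For x y P) = insert x (written_regs P)"
  "written_banks (For x y P) = written_banks P"
  unfolding For_def by auto

text \<open>The invariant takes the index as a number, and by \<open>irrel\<close> it does not look
  at register \<open>x\<close>; hence incrementing the counter preserves it. Frame facts relative to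
  the entry state are supplied to \<open>step\<close> and \<open>final\<close>, which keeps the
  invariants short.\<close>

lemma wp_For:
  assumes xy: "x \<noteq> y" "x \<notin> written_regs P" "y \<notin> written_regs P"
    and B: "r y \<le> B"
    and irrel: "\<And>i r m v. I i (r(x := v)) m = I i r m"
    and init: "I 0 r m"
    and step: "\<And>i r' m'. i < r y \<Longrightarrow> I i r' m' \<Longrightarrow> r' x = i \<Longrightarrow>
      \<forall>z. z \<notin> insert x (written_regs P) \<longrightarrow> r' z = r z \<Longrightarrow>
      \<forall>b. b \<notin> written_banks P \<longrightarrow> m' b = m b \<Longrightarrow> wp B P (I (Suc i)) r' m'"
    and final: "\<And>r' m'. I (r y) r' m' \<Longrightarrow> r' x = r y \<Longrightarrow>
      \<forall>z. z \<notin> insert x (written_regs P) \<longrightarrow> r' z = r z \<Longrightarrow>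
      \<forall>b. b \<notin> written_banks P \<longrightarrow> m' b = m b \<Longrightarrow> Q r' m'"
  shows "wp B (For x y P) Q r m"
proof -
  let ?e = "Minus (Reg y) (Reg x)" and ?P = "Seq P (Assign x (Plus (Reg x) (Const 1)))"
  let ?c = "1 + cost ?e + time_bound B ?P"
  define fr where "fr r' m' \<longleftrightarrow> (\<forall>z. z \<notin> insert x (written_regs P) \<longrightarrow> r' z = r z) \<and>
    (\<forall>b. b \<notin> written_banks P \<longrightarrow> m' b = m b)" for r' and m' :: "nat \<Rightarrow> nat \<Rightarrow> nat"
  \<comment> \<open>Induction on the number \<open>k\<close> of iterations left; the last summand
    pays for the failing exit test.\<close>
  have "\<exists>t r'' m''. exec (While ?e ?P) (r', m') t (r'', m'') \<and> t \<le> k * ?c + (1 + cost ?e) \<and> Q r'' m''"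
    if "k + i = r y" "I i r' m'" "r' x = i" "fr r' m'" for k i r' m'
    using that
  proof (induction k arbitrary: i r' m')
    case 0
    then have "r' y = r y" using xy by (auto simp: fr_def)
    with 0 have "exec (While ?e ?P) (r', m') (1 + cost ?e) (r', m')"
      by (intro exec.While_false) simp
    moreover have "Q r' m'" using 0 by (intro final) (auto simp: fr_def)
    ultimately show ?case by (intro exI[of _ "1 + cost ?e"] exI[of _ r'] exI[of _ m']) auto
  next
    case (Suc k)
    have y: "r' y = r y" using xy Suc by (auto simp: fr_def)
    have "wp B P (I (Suc i)) r' m'" using Suc.prems by (intro step) (auto simp: fr_def)
    then obtain t r1 m1 where P: "exec P (r', m') t (r1, m1)" "t \<le> time_bound B P" "I (Suc i) r1 m1"
      unfolding wp_def by blast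
    note f = exec_frame[OF P(1)]
    let ?r2 = "r1(x := Suc i)"
    have "r1 x = i" using f xy Suc.prems by simp
    then have "exec (Assign x (Plus (Reg x) (Const 1))) (r1, m1) 4 (?r2, m1)"
      using exec.Assign[of x "Plus (Reg x) (Const 1)" "(r1, m1)"] by (simp add: eval_nat_numeral)
    then have body: "exec ?P (r', m') (t + 4) (?r2, m1)" by (rule exec.Seq[OF P(1)])
    have "\<exists>t r'' m''. exec (While ?e ?P) (?r2, m1) t (r'', m'') \<and> t \<le> k * ?c + (1 + cost ?e) \<and> Q r'' m''"
    proof (rule Suc.IH[of "Suc i"])
      show "I (Suc i) ?r2 m1" using P(3) by (simp only: irrel)
    qed (use Suc.prems f in \<open>auto simp: fr_def\<close>)
    then obtain u r'' m'' where u: "exec (While ?e ?P) (?r2, m1) u (r'', m'')"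
      "u \<le> k * ?c + (1 + cost ?e)" "Q r'' m''" by blast
    have "exec (While ?e ?P) (r', m') (1 + cost ?e + (t + 4) + u) (r'', m'')"
      by (rule exec.While_true[OF _ body u(1)]) (use Suc.prems y in simp)
    moreover have "1 + cost ?e + (t + 4) + u \<le> Suc k * ?c + (1 + cost ?e)"
      using u(2) P(2) by simp
    ultimately show ?case using u(3) by blast
  qed
  from this[of "r y" 0 "r(x := 0)" m]
  obtain t r'' m'' where t: "exec (While ?e ?P) (r(x := 0), m) t (r'', m'')"
    "t \<le> r y * ?c + (1 + cost ?e)" "Q r'' m''"
    using init irrel by (auto simp: fr_def)
  have "exec (Assign x (Const 0)) (r, m) 2 (r(x := 0), m)"
    using exec.Assign[of x "Const 0" "(r, m)"] by (simp add: eval_nat_numeral)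
  then have "exec (For x y P) (r, m) (2 + t) (r'', m'')"
    unfolding For_def using t(1) by (rule exec.Seq)
  moreover have "2 + t \<le> time_bound B (For x y P)"
  proof -
    \<comment> \<open>The exit test is charged as a full iteration, whence the factor
      \<open>B + 1\<close> in \<open>time_bound\<close>.\<close>
    have "t \<le> r y * ?c + ?c" using t(2) by simp
    also have "\<dots> \<le> B * ?c + ?c" using B by (intro add_mono mult_right_mono) auto
    finally show ?thesis unfolding For_def by (simp add: algebra_simps)
  qed
  ultimately show ?thesis unfolding wp_def using t(3) by blast
qed

section \<open>Tables for arithmetic\<close>

abbreviation seq (infixr ";;" 60) where "P ;; Q \<equiv> Seq P Q"

lemma mult_add_eq_iff:
  fixes a b x y N :: nat
  assumes "x < N" "y < N"
  shows "a * N + x = b * N + y \<longleftrightarrow> a = b \<and> x = y"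
proof
  assume *: "a * N + x = b * N + y"
  have "a = (a * N + x) div N" "x = (a * N + x) mod N" using assms by auto
  moreover have "b = (b * N + y) div N" "y = (b * N + y) mod N" using assms by auto
  ultimately show "a = b \<and> x = y" using * by metis
qed auto

lemma mult_add_less:
  fixes a x N K :: nat
  assumes "a < K" "x < N"
  shows "a * N + x < K * N"
proof -
  have "a * N + x < Suc a * N" using assms(2) by simp
  also have "\<dots> \<le> K * N" using assms(1) by (intro mult_right_mono) auto
  finally show ?thesis .
qed

text \<open>
  Registers: 2 the zero of the field, 3 \<open>N = q\<^sup>n\<close>, 4 \<open>N\<^sup>2\<close>, 5 the verdict, 6 \<open>q + 1\<close>, 7 \<open>(q + 1) N\<close>,
  the others are scratch. Banks: 4 and 5 multiples of \<open>q\<close> and \<open>N\<close> (the machine cannot multiply),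
  6 and 7 quotients and remainders modulo \<open>q\<close>, 8 digits, 9 and 10 the operations of \<open>g\<close> and \<open>f\<close> on
  encoded vectors, 11 the marked pairs. A vector is encoded by the number below \<open>N\<close> with its
  coordinates as base-\<open>q\<close> digits, most significant first.
\<close>

definition set_sizes :: prog where
  "set_sizes =
     Assign 3 (Const 1);;
     For 8 1 (Assign 9 (Const 0);; For 10 0 (Assign 9 (Plus (Reg 9) (Reg 3)));; Assign 3 (Reg 9));;
     Assign 6 (Plus (Reg 0) (Const 1));;
     Assign 4 (Const 0);; For 8 3 (Assign 4 (Plus (Reg 4) (Reg 3)));;
     Assign 7 (Const 0);; For 8 6 (Assign 7 (Plus (Reg 7) (Reg 3)))"

text \<open>The range \<open>(q + 1) * N\<close> is dictated by bank 5, which must also multiply the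
  row indices \<open>s * N + a\<close> with \<open>s \<le> q\<close> of the operation
  tables.\<close>

definition fill_products :: prog where
  "fill_products =
     Assign 9 (Const 0);; Assign 10 (Const 0);;
     For 8 7 (Store 4 (Reg 8) (Reg 9);; Store 5 (Reg 8) (Reg 10);;
       Assign 9 (Plus (Reg 9) (Reg 0));; Assign 10 (Plus (Reg 10) (Reg 3)))"

text \<open>Quotient and remainder are simply the two loop counters while register 9 counts through
  the dividends. The outer limit \<open>N\<close> makes the table reach up to \<open>N * q\<close>,
  which covers all codes.\<close>

definition fill_divisions :: prog where
  "fill_divisions =
     Assign 9 (Const 0);;
     For 8 3 (For 10 0 (Store 6 (Reg 9) (Reg 8);; Store 7 (Reg 9) (Reg 10);;
       Assign 9 (Plus (Reg 9) (Const 1))))"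

text \<open>Repeated division finds the least significant digit first, whereas coordinate 0 is the
  most significant one; the digit found in pass \<open>j\<close> therefore goes to row
  \<open>n - 1 - j\<close> of bank 8.\<close>

definition fill_digits :: prog where
  "fill_digits =
     For 8 3 (Assign 9 (Reg 8);;
       For 10 1 (
         Store 8 (Plus (Mem 5 (Minus (Minus (Reg 1) (Const 1)) (Reg 10))) (Reg 8)) (Mem 7 (Reg 9));;
         Assign 9 (Mem 6 (Reg 9))))"

text \<open>The labels of field elements are arbitrary, so zero must be recovered from the addition
  table: it is the only \<open>a\<close> with \<open>a + a = a\<close>. The sum of the two truncated
  differences is nonzero iff the numbers differ.\<close>

definition find_zero :: prog where
  "find_zero =
     For 8 0 (Assign 9 (Mem 0 (Plus (Mem 4 (Reg 8)) (Reg 8)));;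
       Cond (Plus (Minus (Reg 9) (Reg 8)) (Minus (Reg 8) (Reg 9))) Skip (Assign 2 (Reg 8)))"

lemmas wp_simple = wp_Seq wp_Assign wp_Store wp_Skip

lemma wp_set_sizes:
  assumes "r 0 = q" "r 1 = n" "q > 0" and B: "(q + 1) * q ^ n * q ^ n \<le> B" "n \<le> B"
  shows "wp B set_sizes (\<lambda>r m. r 3 = q ^ n \<and> r 4 = q ^ n * q ^ n \<and> r 6 = q + 1 \<and> r 7 = (q + 1) * q ^ n) r m"
proof -
  have N: "q ^ n > 0" using assms by simp
  have "(q + 1) * 1 * 1 \<le> (q + 1) * q ^ n * q ^ n" using N by (intro mult_mono) auto
  moreover have "1 * q ^ n * 1 \<le> (q + 1) * q ^ n * q ^ n" using N by (intro mult_mono) auto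
  ultimately have b: "q + 1 \<le> B" "q ^ n \<le> B"
    using order_trans[OF _ B(1)] by (simp_all only: mult_1 mult_1_right)
  show ?thesis
    unfolding set_sizes_def
    apply (intro wp_Seq wp_Assign)
    apply (rule wp_For[where I = "\<lambda>i r m. r 3 = q ^ i"])
           apply (use assms b in simp_all)[6]
    subgoal for i r' m'
      apply (intro wp_Seq wp_Assign)
      apply (rule wp_For[where I = "\<lambda>j r m. r 9 = j * q ^ i"])
             apply (use assms b in simp_all)[6]
      subgoal for j by (intro wp_Assign) simp
      apply (intro wp_Assign) using assms by simp
    apply (intro wp_Seq wp_Assign)
    apply (rule wp_For[where I = "\<lambda>i r m. r 4 = i * q ^ n"])
           apply (use assms b in simp_all)[6]
    subgoal for r' m' j by (intro wp_Assign) (use assms in simp)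
    apply (intro wp_Seq wp_Assign)
    apply (rule wp_For[where I = "\<lambda>i r m. r 7 = i * q ^ n"])
           apply (use assms b in simp_all)[6]
    subgoal for r' m' r'' m'' j by (intro wp_Assign) (use assms in simp)
    using assms by simp
qed

lemma wp_fill_products:
  assumes "r 0 = q" "r 3 = N" "r 7 = L" "L \<le> B"
  shows "wp B fill_products (\<lambda>r m. \<forall>x<L. m 4 x = x * q \<and> m 5 x = x * N) r m"
  unfolding fill_products_def
  apply (intro wp_Seq wp_Assign)
  apply (rule wp_For[where I = "\<lambda>i r m. r 9 = i * q \<and> r 10 = i * N \<and> (\<forall>x<i. m 4 x = x * q \<and> m 5 x = x * N)"])
         apply (use assms in simp_all)[6]
  subgoal for i by (intro wp_simple) (use assms in \<open>simp add: less_Suc_eq\<close>)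
  using assms by simp

lemma wp_fill_divisions:
  assumes "r 0 = q" "r 3 = N" "N \<le> B" "q \<le> B" "q > 0"
  shows "wp B fill_divisions (\<lambda>r m. \<forall>x<N. m 6 x = x div q \<and> m 7 x = x mod q) r m"
  unfolding fill_divisions_def
  apply (intro wp_Seq wp_Assign)
  apply (rule wp_For[where I = "\<lambda>i r m. r 9 = i * q \<and> (\<forall>x<i * q. m 6 x = x div q \<and> m 7 x = x mod q)"])
         apply (use assms in simp_all)[6]
  subgoal for i
    apply (rule wp_For[where I = "\<lambda>j r m. r 9 = i * q + j \<and> (\<forall>x<i * q + j. m 6 x = x div q \<and> m 7 x = x mod q)"])
           apply (use assms in simp_all)[6]
    subgoal for j by (intro wp_simple) (use assms in \<open>simp add: less_Suc_eq\<close>)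
    using assms by (simp add: algebra_simps)
  using assms less_le_trans[of _ N "N * q"] by simp

lemma wp_fill_digits:
  assumes r: "r 1 = n" "r 3 = N" "N \<le> B" "n \<le> B"
    and m: "\<forall>x<N. m 6 x = x div q \<and> m 7 x = x mod q" "\<forall>x<n. m 5 x = x * N"
  shows "wp B fill_digits (\<lambda>r m. \<forall>x<N. \<forall>i<n. m 8 (i * N + x) = x div q ^ (n - 1 - i) mod q) r m"
proof -
  have 1: "wp B fill_digits (\<lambda>r m. \<forall>x<N. \<forall>i<n. m 8 ((n - 1 - i) * N + x) = x div q ^ i mod q) r m"
    unfolding fill_digits_def
    apply (rule wp_For[where I = "\<lambda>x' r m. \<forall>x<x'. \<forall>i<n. m 8 ((n - 1 - i) * N + x) = x div q ^ i mod q"])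
           apply (use r in simp_all)[6]
    subgoal for y r' m'
      apply (intro wp_Seq wp_Assign)
      apply (rule wp_For[where I = "\<lambda>j r m. r 9 = y div q ^ j \<and>
          (\<forall>x<y. \<forall>i<n. m 8 ((n - 1 - i) * N + x) = x div q ^ i mod q) \<and>
          (\<forall>i<j. m 8 ((n - 1 - i) * N + y) = y div q ^ i mod q)"])
             apply (use r in simp_all)[6]
      subgoal for j r'' m''
        apply (intro wp_simple)
        using r m le_less_trans[OF div_le_dividend[of y "q ^ j"], of N]
        by (auto simp: mult_add_eq_iff less_Suc_eq power_Suc2 div_mult2_eq simp del: power_Suc)
      using r by (simp add: less_Suc_eq)
    using r by simp
  show ?thesis
  proof (rule wp_frame[OF 1], intro allI impI)
    fix r' m' x i
    assume "\<forall>x<N. \<forall>i<n. m' 8 ((n - 1 - i) * N + x) = x div q ^ i mod q" "x < N" "i < n"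
    from this(1)[rule_format, of x "n - 1 - i"] this(2-)
    show "m' 8 (i * N + x) = x div q ^ (n - 1 - i) mod q" by simp
  qed
qed

lemma wp_find_zero:
  assumes r: "r 0 = q" "q \<le> B" and m: "\<forall>x<q. m 4 x = x * q"
    and z: "z < q" "\<forall>a<q. m 0 (a * q + a) = a \<longleftrightarrow> a = z"
  shows "wp B find_zero (\<lambda>r m. r 2 = z) r m"
  unfolding find_zero_def
  apply (rule wp_For[where I = "\<lambda>i r m. z < i \<longrightarrow> r 2 = z"])
         apply (use r in simp_all)[6]
  subgoal for i
    apply (intro wp_simple wp_Cond)
    using assms by (auto simp: less_Suc_eq)
  using z r by simp

section \<open>Coordinate vectors and their codes\<close>

text \<open>A Horner scheme over a prefix of the coordinates; the prefix values are the loop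
  invariant when the machine assembles an encoded result.\<close>

primrec encode :: "nat \<Rightarrow> (nat \<Rightarrow> nat) \<Rightarrow> nat \<Rightarrow> nat" where
  "encode q u 0 = 0"
| "encode q u (Suc k) = encode q u k * q + u k"

definition decode :: "nat \<Rightarrow> nat \<Rightarrow> nat \<Rightarrow> nat \<Rightarrow> nat" where
  "decode q n x = (\<lambda>i\<in>{..<n}. x div q ^ (n - 1 - i) mod q)"

lemma encode_less: "(\<And>i. i < k \<Longrightarrow> u i < q) \<Longrightarrow> encode q u k < q ^ k"
proof (induction k)
  case (Suc k)
  then have "encode q u k * q + u k < q ^ k * q" by (intro mult_add_less) auto
  then show ?case by (simp add: mult.commute)
qed simp

text \<open>The Horner value of the first \<open>k\<close> digits is \<open>x\<close> with its last
  \<open>n - k\<close> digits cut off.\<close>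

lemma encode_decode:
  assumes "x < q ^ n"
  shows "encode q (decode q n x) n = x"
proof -
  have "k \<le> n \<Longrightarrow> encode q (decode q n x) k = x div q ^ (n - k)" for k
  proof (induction k)
    case (Suc k)
    then have "n - k = Suc (n - Suc k)" by simp
    then have "x div q ^ (n - k) = x div q ^ (n - Suc k) div q"
      by (simp only: power_Suc2 div_mult2_eq)
    with Suc show ?case by (simp add: decode_def)
  qed (use assms in simp)
  from this[of n] show ?thesis by simp
qed

lemma finite_vecs: "finite (carrier R) \<Longrightarrow> finite (vecs R n)"
  unfolding vecs_def by (intro finite_PiE) auto

lemma card_vecs: "card (vecs R n) = card (carrier R) ^ n"
  unfolding vecs_def by (simp add: card_PiE)

locale coordinate_space =
  fixes R :: "nat ring" (structure) and q n :: nat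
  assumes finite_field: "finite_field R q"
begin

lemma field: "field R" and carrier: "carrier R = {..<q}"
  using finite_field unfolding finite_field_def by auto

sublocale field R by (rule field)

lemma q_ge_2: "q \<ge> 2"
proof -
  have "{\<zero>, \<one>} \<subseteq> {..<q}" using zero_closed one_closed carrier by blast
  then have "card {\<zero>, \<one>} \<le> card {..<q}" by (rule card_mono[OF finite_lessThan])
  then show ?thesis by simp
qed

abbreviation "N \<equiv> q ^ n"
abbreviation "V \<equiv> vecs R n"

lemma less_q: "a \<in> carrier R \<longleftrightarrow> a < q"
  by (simp add: carrier)

lemma decode_closed: "decode q n x \<in> V"
  unfolding vecs_def decode_def carrier using q_ge_2 by auto

text \<open>\<open>encode\<close> is a left inverse, and injectivity between sets of equal size
  gives surjectivity. The other inverse law then follows without any computation of digits.\<close>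

lemma bij_betw_decode: "bij_betw (decode q n) {..<N} V"
proof -
  have inj: "inj_on (decode q n) {..<N}"
    by (rule inj_on_inverseI[where g = "\<lambda>u. encode q u n"]) (simp add: encode_decode)
  have "decode q n ` {..<N} = V"
  proof (rule card_subset_eq)
    show "card (decode q n ` {..<N}) = card V"
      using card_image[OF inj] by (simp add: card_vecs carrier)
  qed (use decode_closed in \<open>auto simp: finite_vecs carrier\<close>)
  with inj show ?thesis by (simp add: bij_betw_def)
qed

lemma decode_encode:
  assumes "u \<in> V"
  shows "decode q n (encode q u n) = u"
proof -
  obtain x where "x < N" "u = decode q n x"
    using assms bij_betw_decode unfolding bij_betw_def by blast
  then show ?thesis by (simp add: encode_decode)
qed

lemma encode_less_N: "u \<in> V \<Longrightarrow> encode q u n < N"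
  by (rule encode_less) (simp add: less_q[symmetric] vecs_memD)

text \<open>
  Linear combinations \<open>s u + w\<close> for the scalars \<open>s < q\<close> and, for \<open>s = q\<close>, the product: closure
  under these \<open>q + 1\<close> operations is being a subalgebra.
\<close>

definition operation where
  "operation f s u w = (if s < q then vadd R n (vscale R n s u) w else f u w)"

lemma algebra_closed: "f \<in> algebras R n \<Longrightarrow> u \<in> V \<Longrightarrow> w \<in> V \<Longrightarrow> f u w \<in> V"
  unfolding algebras_def linear_on_vecs_def by blast

lemma operation_closed:
  "f \<in> algebras R n \<Longrightarrow> u \<in> V \<Longrightarrow> w \<in> V \<Longrightarrow> operation f s u w \<in> V"
  by (simp add: operation_def vadd_closed vscale_closed algebra_closed less_q)

text \<open>The right-hand side defines a linear map that agrees with \<open>L\<close> on unit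
  vectors, and linear maps are determined there.\<close>

lemma linear_expansion:
  assumes L: "linear_on_vecs R n L" and u: "u \<in> V" and k: "k < n"
  shows "L u k = (\<Oplus>i\<in>{..<n}. u i \<otimes> L (unit_vec R n i) k)"
proof -
  define T where "T u = (\<lambda>k\<in>{..<n}. \<Oplus>i\<in>{..<n}. u i \<otimes> L (unit_vec R n i) k)" for u
  have LV: "L u \<in> V" if "u \<in> V" for u using L that unfolding linear_on_vecs_def by blast
  note c = vecs_memD[OF LV[OF unit_vec_closed]]
  have TV: "T u \<in> V" if "u \<in> V" for u
    unfolding T_def vecs_def using c vecs_memD[OF that] by (auto intro!: finsum_closed)
  have "linear_on_vecs R n T"
    unfolding linear_on_vecs_def
  proof (intro conjI ballI funcsetI TV)
    fix u v assume uv: "u \<in> V" "v \<in> V"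
    show "T (vadd R n u v) = vadd R n (T u) (T v)"
    proof (rule vecs_eqI[of _ R n])
      fix k assume k: "k < n"
      show "T (vadd R n u v) k = vadd R n (T u) (T v) k"
        using finsum_vadd[OF uv c[OF k]] k by (simp add: T_def vadd_def)
    qed (use uv TV vadd_closed in auto)
  next
    fix a u assume au: "a \<in> carrier R" "u \<in> V"
    show "T (vscale R n a u) = vscale R n a (T u)"
    proof (rule vecs_eqI[of _ R n])
      fix k assume k: "k < n"
      show "T (vscale R n a u) k = vscale R n a (T u) k"
        using finsum_vscale[OF au c[OF k]] k by (simp add: T_def vscale_def)
    qed (use au TV vscale_closed in auto)
  qed
  moreover have "L (unit_vec R n i) = T (unit_vec R n i)" if "i < n" for i
  proof (rule vecs_eqI[of _ R n])
    fix k assume k: "k < n"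
    show "L (unit_vec R n i) k = T (unit_vec R n i) k"
      using finsum_unit_vec[OF that c[OF k]] k by (simp add: T_def)
  qed (use LV TV unit_vec_closed in auto)
  ultimately have "L u = T u" using linear_on_vecs_eqI[OF L _ _ u] by blast
  then show ?thesis using k by (simp add: T_def)
qed

text \<open>The nesting of the sums is that of the two loops in the program computing a coordinate
  of a product.\<close>

lemma algebra_expansion:
  assumes f: "f \<in> algebras R n" and u: "u \<in> V" and v: "v \<in> V" and k: "k < n"
  shows "f u v k = (\<Oplus>i\<in>{..<n}. u i \<otimes> (\<Oplus>j\<in>{..<n}. v j \<otimes> struct_const R n f (i, j, k)))"
proof -
  have sc: "struct_const R n f (i, j, k) = f (unit_vec R n i) (unit_vec R n j) k"
    "struct_const R n f (i, j, k) \<in> carrier R" if "i < n" "j < n" for i j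
    using that k vecs_memD[OF algebra_closed[OF f unit_vec_closed unit_vec_closed] k]
    by (simp_all add: struct_const_def)
  note vc = vecs_memD[OF u] vecs_memD[OF v]
  have inner: "f (unit_vec R n i) v k = (\<Oplus>j\<in>{..<n}. v j \<otimes> struct_const R n f (i, j, k))"
    if "i < n" for i
  proof -
    have "f (unit_vec R n i) v k = (\<Oplus>j\<in>{..<n}. v j \<otimes> f (unit_vec R n i) (unit_vec R n j) k)"
      using f unit_vec_closed by (intro linear_expansion[OF _ v k]) (auto simp: algebras_def)
    also have "\<dots> = (\<Oplus>j\<in>{..<n}. v j \<otimes> struct_const R n f (i, j, k))"
      by (rule finsum_cong') (use that vc sc in auto)
    finally show ?thesis .
  qed
  have "f u v k = (\<Oplus>i\<in>{..<n}. u i \<otimes> f (unit_vec R n i) v k)"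
    using f v by (intro linear_expansion[OF _ u k]) (auto simp: algebras_def)
  also have "\<dots> = (\<Oplus>i\<in>{..<n}. u i \<otimes> (\<Oplus>j\<in>{..<n}. v j \<otimes> struct_const R n f (i, j, k)))"
    by (rule finsum_cong') (use vc sc inner in \<open>auto intro!: finsum_closed\<close>)
  finally show ?thesis .
qed

end

lemma field_table_nth: "a < q \<Longrightarrow> b < q \<Longrightarrow> field_table q h (a * q + b) = h a b"
  unfolding field_table_def using mult_add_less[of a q b q] by simp

text \<open>For fixed \<open>k\<close> the constants lie at distance \<open>n\<close> from each
  other, so one address starting at \<open>k\<close> visits them in the order of \<open>i\<close>
  and \<open>j\<close>; the index is written accordingly.\<close>

lemma const_table_nth:
  assumes "i < n" "j < n" "k < n"
  shows "const_table n c (k + (i * n + j) * n) = c (i, j, k)"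
proof -
  have a: "i * n + j < n * n" using assms by (intro mult_add_less)
  then have "(i * n + j) * n + k < n * n * n" using assms by (intro mult_add_less)
  then have "k + (i * n + j) * n < n * n * n" by simp
  moreover have "(k + (i * n + j) * n) div n = i * n + j" using assms by simp
  moreover have "(k + (i * n + j) * n) div (n * n) = i"
    unfolding div_mult2_eq using assms by simp
  ultimately show ?thesis using assms by (simp add: const_table_def)
qed

section \<open>Tables for the operations of an algebra\<close>

text \<open>Registers 8 to 11 hold the scalar, the codes of both vectors and the coordinate;
  register 13 receives the result.\<close>

definition linear_coordinate :: prog where
  "linear_coordinate =
     Assign 13 (Mem 0 (Plus
       (Mem 4 (Mem 1 (Plus (Mem 4 (Reg 8)) (Mem 8 (Plus (Mem 5 (Reg 11)) (Reg 9))))))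
       (Mem 8 (Plus (Mem 5 (Reg 11)) (Reg 10)))))"

text \<open>Registers 17 and 13 accumulate the inner and outer sum. Register 14 is the address of
  the current structure constant and runs on through all inner loops without being reset.\<close>

definition product_coordinate :: "nat \<Rightarrow> prog" where
  "product_coordinate src =
     Assign 13 (Reg 2);; Assign 14 (Reg 11);;
     For 15 1 (
       Assign 17 (Reg 2);;
       For 16 1 (
         Assign 17 (Mem 0 (Plus
           (Mem 4 (Mem 1 (Plus (Mem 4 (Mem 8 (Plus (Mem 5 (Reg 16)) (Reg 10)))) (Mem src (Reg 14)))))
           (Reg 17)));;
         Assign 14 (Plus (Reg 14) (Reg 1)));;
       Assign 13 (Mem 0 (Plus
         (Mem 4 (Mem 1 (Plus (Mem 4 (Mem 8 (Plus (Mem 5 (Reg 15)) (Reg 9)))) (Reg 17))))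
         (Reg 13))))"

text \<open>Register 8 runs up to \<open>q\<close> inclusive, and its last value selects the
  product. Register 18 is the running address, register 12 the Horner value of the result.\<close>

definition fill_operations :: "nat \<Rightarrow> nat \<Rightarrow> prog" where
  "fill_operations src dst =
     Assign 18 (Const 0);;
     For 8 6 (For 9 3 (For 10 3 (
       Assign 12 (Const 0);;
       For 11 1 (
         Cond (Minus (Reg 0) (Reg 8)) linear_coordinate (product_coordinate src);;
         Assign 12 (Plus (Mem 4 (Reg 12)) (Reg 13)));;
       Store dst (Reg 18) (Reg 12);;
       Assign 18 (Plus (Reg 18) (Const 1)))))"

lemma written_coordinate [simp]:
  "written_regs linear_coordinate = {13}" "written_banks linear_coordinate = {}"
  "written_regs (product_coordinate src) = {13, 14, 15, 16, 17}"
  "written_banks (product_coordinate src) = {}"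
  unfolding linear_coordinate_def product_coordinate_def by auto

context coordinate_space
begin

text \<open>A common bound for all loop limits, the largest of which are \<open>(q + 1) * N\<close>
  and \<open>N * N\<close>; it is also the length of an operation table.\<close>

abbreviation "size_bound \<equiv> (q + 1) * N * N"

definition tables :: "(nat \<Rightarrow> nat) \<Rightarrow> (nat \<Rightarrow> nat \<Rightarrow> nat) \<Rightarrow> bool" where
  "tables r m \<longleftrightarrow>
     r 0 = q \<and> r 1 = n \<and> r 2 = \<zero> \<and> r 3 = N \<and> r 4 = N * N \<and> r 6 = q + 1 \<and>
     m 0 = field_table q (\<lambda>a b. a \<oplus> b) \<and> m 1 = field_table q (\<lambda>a b. a \<otimes> b) \<and>
     (\<forall>x < (q + 1) * N. m 4 x = x * q \<and> m 5 x = x * N) \<and>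
     (\<forall>x<N. \<forall>i<n. m 8 (i * N + x) = decode q n x i)"

lemma N_pos: "N > 0" using q_ge_2 by simp

lemma n_less_N: "n < N"
  using less_le_trans[OF less_exp power_mono[OF q_ge_2]] by simp

lemma bounds: "q + 1 \<le> size_bound" "N \<le> size_bound" "n \<le> size_bound" "(q + 1) * N \<le> size_bound"
  "N * N \<le> size_bound" "q + 1 \<le> (q + 1) * N" "N \<le> (q + 1) * N"
proof -
  have N: "1 \<le> N" using N_pos by linarith
  show 1: "(q + 1) * N \<le> size_bound" using N by simp
  show 2: "q + 1 \<le> (q + 1) * N" "N \<le> (q + 1) * N"
    using mult_le_mono2[OF N, of "q + 1"] by simp_all
  show "q + 1 \<le> size_bound" "N \<le> size_bound" using 1 2 by linarith+
  then show "n \<le> size_bound" using n_less_N by linarith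
  show "N * N \<le> size_bound" by simp
qed

lemma decode_less_q: "i < n \<Longrightarrow> decode q n x i < q"
  by (simp add: less_q[symmetric] vecs_memD[OF decode_closed])

lemma mult_less_q: "a < q \<Longrightarrow> b < q \<Longrightarrow> a \<otimes> b < q"
  and zero_less_q: "\<zero> < q"
  by (simp_all add: less_q[symmetric])

definition operation_table where
  "operation_table f x =
     encode q (operation f (x div (N * N)) (decode q n (x div N mod N)) (decode q n (x mod N))) n"

lemma operation_table_nth:
  assumes "a < N" "c < N"
  shows "operation_table f ((s * N + a) * N + c) = encode q (operation f s (decode q n a) (decode q n c)) n"
proof -
  have "(b * N + x) div N = b" "(b * N + x) mod N = x" if "x < N" for b x
    using that by (cases "N = 0"; simp)+
  with assms show ?thesis by (simp add: operation_table_def div_mult2_eq)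
qed

lemma finsum_lessThan_Suc:
  assumes "\<And>i. i \<le> k \<Longrightarrow> h i \<in> carrier R"
  shows "(\<Oplus>i\<in>{..<Suc k}. h i) = h k \<oplus> (\<Oplus>i\<in>{..<k}. h i)"
  unfolding lessThan_Suc using assms by (subst finsum_insert) auto

lemma tablesD:
  assumes "tables r m"
  shows "r 0 = q" "r (Suc 0) = n" "r 2 = \<zero>" "r 3 = N" "r 6 = Suc q"
    and "m 0 = field_table q (\<lambda>a b. a \<oplus> b)" "m (Suc 0) = field_table q (\<lambda>a b. a \<otimes> b)"
    and "x < N \<Longrightarrow> i < n \<Longrightarrow> m 8 (i * N + x) = decode q n x i"
    and "x < q \<Longrightarrow> m 4 x = x * q" "x < N \<Longrightarrow> m 4 x = x * q"
    and "x < n \<Longrightarrow> m 5 x = x * N" "x < N \<Longrightarrow> m 5 x = x * N" "x < (q + 1) * N \<Longrightarrow> m 5 x = x * N"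
proof -
  have t: "x < (q + 1) * N \<Longrightarrow> m 4 x = x * q \<and> m 5 x = x * N"
    using assms unfolding tables_def by blast
  then show "x < q \<Longrightarrow> m 4 x = x * q" "x < N \<Longrightarrow> m 4 x = x * q" "x < n \<Longrightarrow> m 5 x = x * N"
    "x < N \<Longrightarrow> m 5 x = x * N" "x < (q + 1) * N \<Longrightarrow> m 5 x = x * N"
    using bounds n_less_N by linarith+
qed (use assms in \<open>simp_all add: tables_def\<close>)

lemma tables_cong:
  assumes "tables r m" "\<And>x. x \<in> {0, 1, 2, 3, 4, 6} \<Longrightarrow> r' x = r x" "\<And>b. b \<in> {0, 1, 4, 5, 8} \<Longrightarrow> m' b = m b"
  shows "tables r' m'"
  using assms unfolding tables_def by simp

lemma wp_linear_coordinate: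
  assumes t: "tables r m" and r: "r 8 = s" "r 9 = x" "r 10 = y" "r 11 = k"
    and less: "s < q" "x < N" "y < N" "k < n"
  shows "wp B linear_coordinate (\<lambda>r m. r 13 = (s \<otimes> decode q n x k) \<oplus> decode q n y k) r m"
proof -
  note look = tablesD[OF t] field_table_nth decode_less_q mult_less_q less r
  have "val (Mem 1 (Plus (Mem 4 (Reg 8)) (Mem 8 (Plus (Mem 5 (Reg 11)) (Reg 9))))) (r, m)
      = s \<otimes> decode q n x k"
    by (simp add: look)
  then show ?thesis
    unfolding linear_coordinate_def by (intro wp_Assign) (simp add: look)
qed

lemma wp_product_coordinate:
  assumes f: "f \<in> algebras R n" and B: "n \<le> B" and t: "tables r m"
    and src: "m src = const_table n (struct_const R n f)"
    and r: "r 9 = x" "r 10 = y" "r 11 = k" and less: "x < N" "y < N" "k < n"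
  shows "wp B (product_coordinate src) (\<lambda>r m. r 13 = f (decode q n x) (decode q n y) k) r m"
proof -
  have cst: "struct_const R n f (i, j, k) < q" if "i < n" "j < n" for i j
    using that less vecs_memD[OF algebra_closed[OF f unit_vec_closed unit_vec_closed]]
    by (simp add: struct_const_def less_q[symmetric])
  \<comment> \<open>These partial sums are the values of the accumulators. Each must be shown to be
    below \<open>q\<close>, because the field tables are meaningful only for such arguments.\<close>
  define summand where "summand i j = decode q n y j \<otimes> struct_const R n f (i, j, k)" for i j
  define inner where "inner i j = (\<Oplus>j'\<in>{..<j}. summand i j')" for i j
  define outer where "outer i = (\<Oplus>i'\<in>{..<i}. decode q n x i' \<otimes> inner i' n)" for i
  have summand: "summand i j < q" if "i < n" "j < n" for i j
    using that unfolding summand_def by (intro mult_less_q decode_less_q cst)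
  have inner: "inner i j < q" if "i < n" "j \<le> n" for i j
    unfolding inner_def less_q[symmetric] by (rule finsum_closed) (use summand that in \<open>auto simp: less_q\<close>)
  have prod: "decode q n x i \<otimes> inner i n < q" if "i < n" for i
    using that by (intro mult_less_q decode_less_q inner) auto
  have outer: "outer i < q" if "i \<le> n" for i
    unfolding outer_def less_q[symmetric]
    by (rule finsum_closed) (use prod that in \<open>auto simp: less_q\<close>)
  have inner_Suc: "inner i (Suc j) = summand i j \<oplus> inner i j" if "i < n" "j < n" for i j
    unfolding inner_def by (rule finsum_lessThan_Suc) (use summand that in \<open>auto simp: less_q\<close>)
  have outer_Suc: "outer (Suc i) = (decode q n x i \<otimes> inner i n) \<oplus> outer i" if "i < n" for i
    unfolding outer_def by (rule finsum_lessThan_Suc) (use prod that in \<open>auto simp: less_q\<close>)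
  have outer_n: "outer n = f (decode q n x) (decode q n y) k"
    unfolding outer_def inner_def summand_def
    using algebra_expansion[OF f decode_closed decode_closed less(3)] by simp
  have zeros: "inner i 0 = \<zero>" "outer 0 = \<zero>" for i
    unfolding inner_def outer_def by simp_all
  note look = tablesD[OF t] field_table_nth decode_less_q less r
  show ?thesis
    unfolding product_coordinate_def
    apply (intro wp_Seq wp_Assign)
    apply (rule wp_For[where I = "\<lambda>i r m. r 13 = outer i \<and> r 14 = k + i * n * n"])
           apply (use look B zeros in simp_all)[6]
    subgoal for i r1 m1
      apply (intro wp_Seq wp_Assign)
      apply (rule wp_For[where I = "\<lambda>j r m. r 17 = inner i j \<and> r 14 = k + (i * n + j) * n"])
             apply (use look B zeros in \<open>simp_all add: algebra_simps\<close>)[6]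
      subgoal for j r2 m2
        apply (intro wp_Seq wp_Assign)
        using src inner[of i j] summand[of i j] cst[of i j]
        by (simp add: look inner_Suc const_table_nth summand_def[symmetric])
      apply (intro wp_Assign)
      using src outer[of i] inner[of i n] prod[of i]
      by (simp add: look outer_Suc)
    using look outer_n by simp
qed

lemma wp_fill_operations:
  assumes f: "f \<in> algebras R n" and B: "size_bound \<le> B"
    and t: "tables r m" and src: "m src = const_table n (struct_const R n f)"
    and dst: "dst > 8" "dst \<noteq> src"
  shows "wp B (fill_operations src dst)
    (\<lambda>r m. \<forall>x < (q + 1) * N * N. m dst x = operation_table f x) r m"
proof -
  note b = order_trans[OF bounds(1) B] order_trans[OF bounds(2) B] order_trans[OF bounds(3) B]
  define Op where "Op s x y = operation f s (decode q n x) (decode q n y)" for s x y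
  \<comment> \<open>Prefix codes stay below \<open>N\<close>, so multiplying them by
    \<open>q\<close> remains inside the table in bank 4.\<close>
  have enc: "encode q (Op s x y) k < N" if "k \<le> n" for s x y k
    unfolding Op_def
  proof (rule less_le_trans[OF encode_less])
    show "operation f s (decode q n x) (decode q n y) i < q" if "i < k" for i
      using vecs_memD[OF operation_closed[OF f decode_closed decode_closed]] less_q that \<open>k \<le> n\<close> by simp
    show "q ^ k \<le> N" using that q_ge_2 by (intro power_increasing) auto
  qed
  have lin: "Op s x y k = (s \<otimes> decode q n x k) \<oplus> decode q n y k" if "s < q" "k < n" for s x y k
    using that by (simp add: Op_def operation_def vadd_def vscale_def)
  have prd: "Op s x y k = f (decode q n x) (decode q n y) k" if "\<not> s < q" for s x y k
    using that by (simp add: Op_def operation_def)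
  have coordinate: "wp B (Cond (Minus (Reg 0) (Reg 8)) linear_coordinate (product_coordinate src))
      (\<lambda>r m. r 13 = Op s x y k) r m"
    if "tables r m" "m src = const_table n (struct_const R n f)"
      "r 8 = s" "r 9 = x" "r 10 = y" "r 11 = k" "x < N" "y < N" "k < n" for r m s x y k
  proof (rule wp_Cond)
    assume "val (Minus (Reg 0) (Reg 8)) (r, m) \<noteq> 0"
    then have s: "s < q" using that by (simp add: tablesD)
    from lin[OF this \<open>k < n\<close>] show "wp B linear_coordinate (\<lambda>r m. r 13 = Op s x y k) r m"
      using wp_linear_coordinate[OF that(1,3-6) s that(7-9)] by simp
  next
    assume "val (Minus (Reg 0) (Reg 8)) (r, m) = 0"
    then have s: "\<not> s < q" using that by (simp add: tablesD)
    from prd[OF this] show "wp B (product_coordinate src) (\<lambda>r m. r 13 = Op s x y k) r m"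
      using wp_product_coordinate[OF f b(3) that(1,2,4-9)] by simp
  qed
  note tr = tablesD(1-5)[OF t] and look = tablesD[OF t]
  show ?thesis
    unfolding fill_operations_def
    apply (intro wp_Seq wp_Assign)
    apply (rule wp_For[where I = "\<lambda>s r m. r 18 = s * N * N \<and> (\<forall>x<s * N * N. m dst x = operation_table f x)"])
           apply (use tr b in simp_all)[6]
    subgoal for s r1 m1
      apply (rule wp_For[where I = "\<lambda>x r m. r 18 = (s * N + x) * N \<and> (\<forall>z<(s * N + x) * N. m dst z = operation_table f z)"])
             apply (use tr b in simp_all)[6]
      subgoal for x r2 m2
        apply (rule wp_For[where I = "\<lambda>y r m. r 18 = (s * N + x) * N + y \<and> (\<forall>z<(s * N + x) * N + y. m dst z = operation_table f z)"])
               apply (use tr b in simp_all)[6]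
        subgoal for y r3 m3
          apply (intro wp_Seq wp_Assign)
          apply (rule wp_For[where I = "\<lambda>k r m. r 12 = encode q (Op s x y) k"])
                 apply (use tr b in simp_all)[6]
          subgoal for k r4 m4
            apply (rule wp_Seq)
            apply (rule wp_frame[OF coordinate[where s = s and x = x and y = y and k = k]])
                     apply (rule tables_cong[OF t])
                      apply (use dst in auto)[2]
                    apply (use dst src tr in simp_all)[8]
            apply (intro wp_Assign)
            using dst enc[of k s x y] by (simp add: look)
          apply (intro wp_simple)
          using dst tr by (simp add: less_Suc_eq operation_table_nth Op_def)
        using tr by (simp add: algebra_simps)
      using tr by (simp add: algebra_simps)
    using tr by simp
qed

end

section \<open>Closures of pairs\<close>

text \<open>With the \<open>q + 1\<close> operations on both sides this is the subalgebra of the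
  product generated by \<open>p\<close>: the combinations \<open>s u + w\<close> include
  \<open>- u + u = 0\<close>.\<close>

inductive_set generated ::
  "nat \<Rightarrow> (nat \<Rightarrow> 'a \<Rightarrow> 'a \<Rightarrow> 'a) \<Rightarrow> (nat \<Rightarrow> 'b \<Rightarrow> 'b \<Rightarrow> 'b) \<Rightarrow> 'a \<times> 'b \<Rightarrow> ('a \<times> 'b) set"
  for K op1 op2 p where
  base: "p \<in> generated K op1 op2 p"
| step: "(a, b) \<in> generated K op1 op2 p \<Longrightarrow> (c, d) \<in> generated K op1 op2 p \<Longrightarrow> s < K \<Longrightarrow>
    (op1 s a c, op2 s b d) \<in> generated K op1 op2 p"

text \<open>Phrased by row and column counts because these are what the machine can add up from the
  marks.\<close>

definition bijection_graph :: "nat \<Rightarrow> (nat \<times> nat) set \<Rightarrow> bool" where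
  "bijection_graph N A \<longleftrightarrow>
     (\<forall>a<N. card {b. b < N \<and> (a, b) \<in> A} = 1 \<and> card {b. b < N \<and> (b, a) \<in> A} = 1)"

definition clear_marks :: prog where
  "clear_marks = For 10 4 (Store 11 (Reg 10) (Const 0));;
     Store 11 (Plus (Mem 5 (Reg 8)) (Reg 9)) (Const 1)"

definition closure_step :: prog where
  "closure_step =
     Cond (Mem 11 (Plus (Mem 5 (Reg 12)) (Reg 13)))
       (Cond (Mem 11 (Plus (Mem 5 (Reg 14)) (Reg 15)))
          (Store 11
            (Plus
              (Mem 5 (Mem 9 (Plus (Mem 5 (Plus (Mem 5 (Reg 11)) (Reg 12))) (Reg 14))))
              (Mem 10 (Plus (Mem 5 (Plus (Mem 5 (Reg 11)) (Reg 13))) (Reg 15))))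
            (Const 1))
          Skip)
       Skip"

definition closure_round :: prog where
  "closure_round = For 11 6 (For 12 3 (For 13 3 (For 14 3 (For 15 3 closure_step))))"

text \<open>Register 18 adds the deviations of all row and column counts from 1, so it is zero iff
  the marks form a bijection. The verdict in register 5 is only ever raised, never reset
  here.\<close>

definition check_bijection :: prog where
  "check_bijection =
     Assign 18 (Const 0);;
     For 12 3 (
       Assign 16 (Const 0);; Assign 17 (Const 0);;
       For 13 3 (
         Assign 16 (Plus (Reg 16) (Mem 11 (Plus (Mem 5 (Reg 12)) (Reg 13))));;
         Assign 17 (Plus (Reg 17) (Mem 11 (Plus (Mem 5 (Reg 13)) (Reg 12)))));;
       Assign 18 (Plus (Reg 18) (Plus
         (Plus (Minus (Reg 16) (Const 1)) (Minus (Const 1) (Reg 16)))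
         (Plus (Minus (Reg 17) (Const 1)) (Minus (Const 1) (Reg 17))))));;
     Cond (Reg 18) Skip (Assign 5 (Const 1))"

definition search :: prog where
  "search =
     Assign 5 (Const 0);;
     For 8 3 (For 9 3 (
       clear_marks;; For 10 4 closure_round;; check_bijection));;
     Assign 0 (Reg 5)"

lemma written_search_parts [simp]:
  "written_regs clear_marks = {10}" "written_banks clear_marks = {11}"
  "written_regs closure_step = {}" "written_banks closure_step = {11}"
  "written_regs closure_round = {11, 12, 13, 14, 15}" "written_banks closure_round = {11}"
  "written_regs check_bijection = {5, 12, 13, 16, 17, 18}" "written_banks check_bijection = {}"
  unfolding clear_marks_def closure_step_def closure_round_def check_bijection_def by auto

section \<open>Correctness of the saturation process\<close>

definition marks :: "nat \<Rightarrow> (nat \<Rightarrow> nat \<Rightarrow> nat) \<Rightarrow> (nat \<times> nat) set \<Rightarrow> bool" where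
  "marks N m A \<longleftrightarrow> A \<subseteq> {..<N} \<times> {..<N} \<and>
     (\<forall>a<N. \<forall>b<N. m 11 (a * N + b) = of_bool ((a, b) \<in> A))"

lemma marks_insert:
  assumes "marks N m A" "a < N" "b < N" "m' 11 = (m 11)(a * N + b := 1)"
  shows "marks N m' (insert (a, b) A)"
  using assms unfolding marks_def by (auto simp: mult_add_eq_iff)

text \<open>The search depends only on two families of operations on codes, so it is verified
  without reference to fields or linearity.\<close>

locale pair_operations =
  fixes N K B :: nat and op1 op2 :: "nat \<Rightarrow> nat \<Rightarrow> nat \<Rightarrow> nat"
  assumes op1_less: "s < K \<Longrightarrow> a < N \<Longrightarrow> c < N \<Longrightarrow> op1 s a c < N"
    and op2_less: "s < K \<Longrightarrow> a < N \<Longrightarrow> c < N \<Longrightarrow> op2 s a c < N"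
    and bounds: "N * N \<le> B" "N \<le> B" "K \<le> B" "1 \<le> K"
begin

abbreviation "G \<equiv> generated K op1 op2"

lemma generated_subset:
  assumes "p \<in> {..<N} \<times> {..<N}"
  shows "G p \<subseteq> {..<N} \<times> {..<N}"
proof
  fix z assume "z \<in> G p"
  then show "z \<in> {..<N} \<times> {..<N}"
    by induction (use assms op1_less op2_less in auto)
qed

definition op_tables :: "(nat \<Rightarrow> nat) \<Rightarrow> (nat \<Rightarrow> nat \<Rightarrow> nat) \<Rightarrow> bool" where
  "op_tables r m \<longleftrightarrow> r 3 = N \<and> r 4 = N * N \<and> r 6 = K \<and> (\<forall>x<K * N. m 5 x = x * N) \<and>
     (\<forall>s<K. \<forall>a<N. \<forall>c<N. m 9 ((s * N + a) * N + c) = op1 s a c \<and> m 10 ((s * N + a) * N + c) = op2 s a c)"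

lemma op_tablesD:
  assumes "op_tables r m"
  shows "r 3 = N" "r 4 = N * N" "r 6 = K" "x < N \<Longrightarrow> m 5 x = x * N"
    "s < K \<Longrightarrow> 0 < N \<Longrightarrow> m 5 s = s * N"
    "s < K \<Longrightarrow> a < N \<Longrightarrow> m 5 (s * N + a) = (s * N + a) * N"
    "s < K \<Longrightarrow> a < N \<Longrightarrow> c < N \<Longrightarrow> m 9 ((s * N + a) * N + c) = op1 s a c"
    "s < K \<Longrightarrow> a < N \<Longrightarrow> c < N \<Longrightarrow> m 10 ((s * N + a) * N + c) = op2 s a c"
proof -
  have t: "x < K * N \<Longrightarrow> m 5 x = x * N" for x using assms unfolding op_tables_def by blast
  have "1 * N \<le> K * N" using bounds(4) by (rule mult_right_mono) simp
  then show "x < N \<Longrightarrow> m 5 x = x * N" by (intro t) linarith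
  show "s < K \<Longrightarrow> a < N \<Longrightarrow> m 5 (s * N + a) = (s * N + a) * N"
    by (intro t mult_add_less)
  show "s < K \<Longrightarrow> 0 < N \<Longrightarrow> m 5 s = s * N"
    by (intro t) (rule less_le_trans[of s K], simp_all)
qed (use assms in \<open>simp_all add: op_tables_def\<close>)

lemma op_tables_cong:
  assumes "op_tables r m" "\<And>x. x \<in> {3, 4, 6} \<Longrightarrow> r' x = r x" "\<And>b. b \<in> {5, 9, 10} \<Longrightarrow> m' b = m b"
  shows "op_tables r' m'"
  using assms unfolding op_tables_def by simp

lemma wp_clear_marks:
  assumes t: "op_tables r m" and r: "r 8 = x" "r 9 = v" "x < N" "v < N"
  shows "wp B clear_marks (\<lambda>r m. marks N m {(x, v)}) r m"
  unfolding clear_marks_def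
  apply (rule wp_Seq)
  apply (rule wp_For[where I = "\<lambda>i r m. \<forall>z<i. m 11 z = 0"])
         apply (use op_tablesD(1-3)[OF t] bounds in simp_all)[6]
  subgoal for i r' m' by (intro wp_Store) (simp add: less_Suc_eq)
  subgoal for r' m'
    apply (rule wp_Store)
    apply (rule marks_insert[where m = m'])
    using r op_tablesD[OF t] mult_add_less[of _ N _ N] by (auto simp: marks_def)
  done

text \<open>\<open>A\<close> is the set marked when the round starts, \<open>D\<close> the
  quintuples already treated. Closure is demanded only for pairs from \<open>A\<close>, since a mark
  added during the round may come too late for combinations already passed;
  \<open>A' \<subseteq> G p\<close> records soundness.\<close>

definition round_inv where
  "round_inv p A D m \<longleftrightarrow> (\<exists>A'. marks N m A' \<and> A \<subseteq> A' \<and> A' \<subseteq> G p \<and>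
     (\<forall>s a b c d. s < K \<longrightarrow> (a, b) \<in> A \<longrightarrow> (c, d) \<in> A \<longrightarrow> D s a b c d \<longrightarrow> (op1 s a c, op2 s b d) \<in> A'))"

text \<open>Pairs in \<open>A\<close> have entries below \<open>N\<close>, so the treated sets need
  to be compared only there. This is how a finished inner loop counts as one more step of the loop
  around it, in lexicographic order.\<close>

lemma round_inv_mono:
  assumes "round_inv p A D m" and A: "A \<subseteq> {..<N} \<times> {..<N}"
    and "\<And>s a b c d. s < K \<Longrightarrow> a < N \<Longrightarrow> b < N \<Longrightarrow> c < N \<Longrightarrow> d < N \<Longrightarrow> D' s a b c d \<Longrightarrow> D s a b c d"
  shows "round_inv p A D' m"
proof -
  have "a < N \<and> b < N" if "(a, b) \<in> A" for a b using A that by blast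
  with assms(1,3) show ?thesis unfolding round_inv_def by meson
qed

lemma wp_closure_step:
  assumes t: "op_tables r m" and A: "A \<subseteq> {..<N} \<times> {..<N}" and inv: "round_inv p A D m"
    and r: "r 11 = s" "r 12 = a" "r 13 = b" "r 14 = c" "r 15 = d"
    and less: "s < K" "a < N" "b < N" "c < N" "d < N"
  shows "wp B closure_step
     (\<lambda>r m. round_inv p A (\<lambda>s' a' b' c' d'. D s' a' b' c' d' \<or> (s', a', b', c', d') = (s, a, b, c, d)) m) r m"
proof -
  obtain A' where A': "marks N m A'" "A \<subseteq> A'" "A' \<subseteq> G p"
    and D: "\<And>s a b c d. s < K \<Longrightarrow> (a, b) \<in> A \<Longrightarrow> (c, d) \<in> A \<Longrightarrow> D s a b c d \<Longrightarrow> (op1 s a c, op2 s b d) \<in> A'"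
    using inv unfolding round_inv_def by blast
  have N: "0 < N" using less by simp
  note look = op_tablesD[OF t] less r N op1_less op2_less
  have mem: "m 11 (a * N + b) = of_bool ((a, b) \<in> A')" if "a < N" "b < N" for a b
    using A'(1) that unfolding marks_def by blast
  have val: "val (Plus
      (Mem 5 (Mem 9 (Plus (Mem 5 (Plus (Mem 5 (Reg 11)) (Reg 12))) (Reg 14))))
      (Mem 10 (Plus (Mem 5 (Plus (Mem 5 (Reg 11)) (Reg 13))) (Reg 15)))) (r, m)
    = op1 s a c * N + op2 s b d"
    by (simp add: look)
  have ins: "marks N (m(11 := (m 11)(op1 s a c * N + op2 s b d := 1))) (insert (op1 s a c, op2 s b d) A')"
    by (rule marks_insert[OF A'(1)]) (use look in simp_all)
  show ?thesis
    unfolding closure_step_def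
    apply (intro wp_Cond wp_Store wp_Skip)
      apply (subst val)
      apply (unfold round_inv_def)
      apply (rule exI[of _ "insert (op1 s a c, op2 s b d) A'"])
      apply (use ins A' D in \<open>auto simp: look mem intro: generated.step[OF _ _ less(1)]\<close>)[1]
     \<comment> \<open>One of the two pairs is unmarked, hence not in \<open>A\<close>, and the new
       quintuple imposes no condition.\<close>
     apply (rule exI[of _ A'])
     apply (use A' D in \<open>auto simp: look mem\<close>)[1]
    apply (rule exI[of _ A'])
    apply (use A' D in \<open>auto simp: look mem\<close>)[1]
    done
qed

lemma wp_closure_round:
  assumes t: "op_tables r m" and A: "marks N m A" "A \<subseteq> G p"
  shows "wp B closure_round (\<lambda>r m. \<exists>A'. marks N m A' \<and> A \<subseteq> A' \<and> A' \<subseteq> G p \<and>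
     (\<forall>s a b c d. s < K \<longrightarrow> (a, b) \<in> A \<longrightarrow> (c, d) \<in> A \<longrightarrow> (op1 s a c, op2 s b d) \<in> A')) r m"
proof -
  have AN: "A \<subseteq> {..<N} \<times> {..<N}" using A(1) unfolding marks_def by blast
  have init: "round_inv p A (\<lambda>_ _ _ _ _. False) m"
    using A unfolding round_inv_def by blast
  note mono = round_inv_mono[OF _ AN]
  note tr = op_tablesD(1-3)[OF t] and b = bounds
  have "wp B closure_round (\<lambda>r m. round_inv p A (\<lambda>_ _ _ _ _. True) m) r m"
    unfolding closure_round_def
    apply (rule wp_For[where I = "\<lambda>i r m. round_inv p A (\<lambda>s a b c d. s < i) m"])
           apply (use tr b init in simp_all)[6]
     subgoal for s r1 m1
       apply (rule wp_For[where I = "\<lambda>i r m. round_inv p A (\<lambda>s' a b c d. s' < s \<or> s' = s \<and> a < i) m"])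
              apply (use tr b in simp_all)[6]
        subgoal for a r2 m2
          apply (rule wp_For[where I = "\<lambda>i r m. round_inv p A (\<lambda>s' a' b c d. s' < s \<or> s' = s \<and> (a' < a \<or> a' = a \<and> b < i)) m"])
                 apply (use tr b in simp_all)[6]
           subgoal for b r3 m3
             apply (rule wp_For[where I = "\<lambda>i r m. round_inv p A (\<lambda>s' a' b' c d. s' < s \<or> s' = s \<and> (a' < a \<or> a' = a \<and> (b' < b \<or> b' = b \<and> c < i))) m"])
                    apply (use tr \<open>N \<le> B\<close> in simp_all)[6]
              subgoal for c r4 m4
                apply (rule wp_For[where I = "\<lambda>i r m. round_inv p A (\<lambda>s' a' b' c' d. s' < s \<or> s' = s \<and> (a' < a \<or> a' = a \<and> (b' < b \<or> b' = b \<and> (c' < c \<or> c' = c \<and> d < i)))) m"])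
                       apply (use tr \<open>N \<le> B\<close> in simp_all)[6]
                 subgoal for d r5 m5
                   apply (rule wp_frame)
                    apply (rule wp_closure_step[OF op_tables_cong[OF t] AN, where s = s and a = a and b = b and c = c and d = d])
                               apply (use tr in auto)[13]
                   apply (erule mono)
                   apply (auto simp: less_Suc_eq)
                   done
                apply (erule mono)
                using tr by (auto simp: less_Suc_eq)
             apply (erule mono)
             using tr by (auto simp: less_Suc_eq)
          apply (erule mono)
          using tr by (auto simp: less_Suc_eq)
       apply (erule mono)
       using tr by (auto simp: less_Suc_eq)
    apply (erule mono)
    using tr by (auto simp: less_Suc_eq)
  then show ?thesis by (rule wp_frame) (auto simp: round_inv_def)
qed

text \<open>A round that does not start from a closed set enlarges it. As at most
  \<open>N * N\<close> pairs exist, the set is closed after \<open>N * N\<close> rounds, and a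
  closed set between \<open>{p}\<close> and \<open>G p\<close> is \<open>G p\<close>.\<close>

lemma wp_closure:
  assumes t: "op_tables r m" and p: "p \<in> {..<N} \<times> {..<N}" and m: "marks N m {p}"
  shows "wp B (For 10 4 closure_round) (\<lambda>r m. marks N m (G p)) r m"
proof -
  define closed where
    "closed A \<longleftrightarrow> (\<forall>s a b c d. s < K \<longrightarrow> (a, b) \<in> A \<longrightarrow> (c, d) \<in> A \<longrightarrow> (op1 s a c, op2 s b d) \<in> A)" for A
  have closed: "A = G p" if "closed A" "p \<in> A" "A \<subseteq> G p" for A
  proof -
    have "z \<in> A" if "z \<in> G p" for z
      using that by induction (use \<open>closed A\<close> \<open>p \<in> A\<close> in \<open>auto simp: closed_def\<close>)
    with that show ?thesis by blast
  qed
  define J where "J i m \<longleftrightarrow> (\<exists>A. marks N m A \<and> p \<in> A \<and> A \<subseteq> G p \<and> (closed A \<or> card A > i))" for i m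
  note tr = op_tablesD(1-3)[OF t]
  show ?thesis
  proof (rule wp_For[where I = "\<lambda>i r. J i"])
    show "J 0 m" unfolding J_def by (rule exI[of _ "{p}"]) (use m in \<open>auto intro: generated.base\<close>)
  next
    fix i r' m'
    assume J: "J i m'" and fr: "\<forall>z. z \<notin> insert 10 (written_regs closure_round) \<longrightarrow> r' z = r z"
      "\<forall>b. b \<notin> written_banks closure_round \<longrightarrow> m' b = m b"
    have t': "op_tables r' m'" by (rule op_tables_cong[OF t]) (use fr in auto)
    obtain A where A: "marks N m' A" "p \<in> A" "A \<subseteq> G p" "closed A \<or> card A > i"
      using J unfolding J_def by blast
    show "wp B closure_round (\<lambda>r. J (Suc i)) r' m'"
    proof (rule wp_frame[OF wp_closure_round[OF t' A(1,3)]])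
      fix r'' m''
      assume "\<exists>A'. marks N m'' A' \<and> A \<subseteq> A' \<and> A' \<subseteq> G p \<and>
        (\<forall>s a b c d. s < K \<longrightarrow> (a, b) \<in> A \<longrightarrow> (c, d) \<in> A \<longrightarrow> (op1 s a c, op2 s b d) \<in> A')"
      then obtain A' where A': "marks N m'' A'" "A \<subseteq> A'" "A' \<subseteq> G p"
        and op: "\<And>s a b c d. s < K \<Longrightarrow> (a, b) \<in> A \<Longrightarrow> (c, d) \<in> A \<Longrightarrow> (op1 s a c, op2 s b d) \<in> A'"
        by blast
      have "closed A' \<or> card A' > Suc i"
      proof (cases "closed A")
        case True
        then have "A' = A" using closed[OF _ A(2,3)] A'(2,3) by blast
        with True show ?thesis by simp
      next
        case False
        then have "A \<subset> A'" using op A'(2) unfolding closed_def by blast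
        moreover have "finite A'" using A'(1) finite_subset unfolding marks_def by blast
        ultimately have "card A < card A'" by (intro psubset_card_mono)
        with False A(4) show ?thesis by simp
      qed
      with A' A(2) show "J (Suc i) m''" unfolding J_def by blast
    qed
  next
    fix r' m' assume "J (r 4) m'"
    then obtain A where A: "marks N m' A" "p \<in> A" "A \<subseteq> G p" "closed A \<or> card A > N * N"
      unfolding J_def tr by blast
    have "card A \<le> card ({..<N} \<times> {..<N})"
      by (rule card_mono) (use A(1) in \<open>auto simp: marks_def\<close>)
    then have "closed A" using A(4) by (simp add: card_cartesian_product)
    with A show "marks N m' (G p)" using closed by blast
  qed (use tr bounds in simp_all)
qed

lemma card_less_Suc_filter:
  "card {b. b < Suc j \<and> P b} = card {b. b < j \<and> P b} + of_bool (P j)"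
proof -
  have "{b. b < Suc j \<and> P b} = (if P j then insert j {b. b < j \<and> P b} else {b. b < j \<and> P b})"
    by (auto simp: less_Suc_eq)
  then show ?thesis by simp
qed

lemma wp_check_bijection:
  assumes t: "op_tables r m" and m: "marks N m A" and r5: "r 5 = of_bool Q"
  shows "wp B check_bijection (\<lambda>r m. r 5 = of_bool (Q \<or> bijection_graph N A)) r m"
proof -
  note tr = op_tablesD(1-4)[OF t]
  have mem: "m 11 (a * N + b) = of_bool ((a, b) \<in> A)" if "a < N" "b < N" for a b
    using m that unfolding marks_def by blast
  show ?thesis
    unfolding check_bijection_def
    apply (intro wp_Seq wp_Assign)
    apply (rule wp_For[where I = "\<lambda>i r m. r 18 = 0 \<longleftrightarrow>
        (\<forall>a<i. card {b. b < N \<and> (a, b) \<in> A} = 1 \<and> card {b. b < N \<and> (b, a) \<in> A} = 1)"])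
           apply (use tr bounds in simp_all)[6]
    subgoal for a r1 m1
      apply (intro wp_Seq wp_Assign)
      apply (rule wp_For[where I = "\<lambda>j r m. r 16 = card {b. b < j \<and> (a, b) \<in> A} \<and> r 17 = card {b. b < j \<and> (b, a) \<in> A}"])
             apply (use tr bounds in simp_all)[6]
      subgoal for b r2 m2
        apply (intro wp_Seq wp_Assign)
        by (simp add: tr mem card_less_Suc_filter)
      apply (rule wp_Assign)
      using tr by (auto simp: less_Suc_eq)
    apply (rule wp_Cond)
     apply (rule wp_Skip)
    using tr r5 apply (simp add: bijection_graph_def)
    apply (rule wp_Assign)
    using tr r5 by (simp add: bijection_graph_def)
qed

lemma wp_search:
  assumes t: "op_tables r m"
  shows "wp B search (\<lambda>r m. r 0 \<noteq> 0 \<longleftrightarrow> (\<exists>x<N. \<exists>v<N. bijection_graph N (G (x, v)))) r m"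
proof -
  note tr = op_tablesD(1-3)[OF t]
  define P where "P x v \<longleftrightarrow> bijection_graph N (G (x, v))" for x v
  have body: "wp B (clear_marks;; For 10 4 closure_round;; check_bijection)
      (\<lambda>r m. r 5 = of_bool (Q \<or> P x v)) r' m'"
    if t: "op_tables r' m'" and r: "r' 8 = x" "r' 9 = v" "x < N" "v < N" "r' 5 = of_bool Q" for r' m' x v Q
    apply (rule wp_Seq)
    apply (rule wp_frame[OF wp_clear_marks[OF t r(1-4)]])
    subgoal for r1 m1
      apply (rule wp_Seq)
      apply (rule wp_frame[OF wp_closure[OF op_tables_cong[OF t], where p = "(x, v)"]])
          apply (use r in auto)[4]
      subgoal for r2 m2
        unfolding P_def
        apply (rule wp_check_bijection[OF op_tables_cong[OF t]])
        using r by auto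
      done
    done
  show ?thesis
    unfolding search_def
    apply (intro wp_Seq wp_Assign)
    apply (rule wp_For[where I = "\<lambda>i r m. r 5 = of_bool (\<exists>x<i. \<exists>v<N. P x v)"])
           apply (use tr bounds in simp_all)[6]
    subgoal for x r1 m1
      apply (rule wp_For[where I = "\<lambda>i r m. r 5 = of_bool ((\<exists>x'<x. \<exists>v<N. P x' v) \<or> (\<exists>v<i. P x v))"])
             apply (use tr bounds in simp_all)[6]
      subgoal for v r2 m2
        apply (rule wp_frame)
         apply (rule body[OF op_tables_cong[OF t], where x = x and v = v
              and Q = "(\<exists>x'<x. \<exists>v<N. P x' v) \<or> (\<exists>v'<v. P x v')"])
               apply auto[2]
             apply (use tr in simp_all)[5]
        apply (simp add: less_Suc_eq ex_disj_distrib conj_disj_distribR disj_commute disj_left_commute)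
        done
      using tr by (simp add: less_Suc_eq ex_disj_distrib conj_disj_distribR)
    apply (rule wp_Assign)
    using tr by (simp add: P_def)
qed

end

section \<open>The algorithm\<close>

text \<open>Bank 3 contains \<open>g\<close> and bank 2 contains \<open>f\<close>, so first
  components of pairs are multiplied by \<open>g\<close> and second ones by \<open>f\<close>: the
  bijection found maps \<open>g\<close> to \<open>f\<close>, the direction of \<open>T\<close> in
  \<open>alg_isomorphic\<close>.\<close>

definition isomorphism_test :: prog where
  "isomorphism_test =
     set_sizes;; fill_products;; fill_divisions;; fill_digits;; find_zero;;
     fill_operations 3 9;; fill_operations 2 10;; search"

lemma written_phases [simp]:
  "written_regs set_sizes = {3, 4, 6, 7, 8, 9, 10}" "written_banks set_sizes = {}"
  "written_regs fill_products = {8, 9, 10}" "written_banks fill_products = {4, 5}"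
  "written_regs fill_divisions = {8, 9, 10}" "written_banks fill_divisions = {6, 7}"
  "written_regs fill_digits = {8, 9, 10}" "written_banks fill_digits = {8}"
  "written_regs find_zero = {2, 8, 9}" "written_banks find_zero = {}"
  "written_regs (fill_operations src dst) = {8, 9, 10, 11, 12, 13, 14, 15, 16, 17, 18}"
  "written_banks (fill_operations src dst) = {dst}"
  unfolding set_sizes_def fill_products_def fill_divisions_def fill_digits_def find_zero_def
    fill_operations_def by auto

context coordinate_space
begin

definition code_operation where
  "code_operation f s a c = encode q (operation f s (decode q n a) (decode q n c)) n"

lemma code_operation_less: "f \<in> algebras R n \<Longrightarrow> code_operation f s a c < N"
  unfolding code_operation_def by (intro encode_less_N operation_closed decode_closed)

lemma pair_operations:
  assumes "f \<in> algebras R n" "g \<in> algebras R n"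
  shows "pair_operations N (q + 1) size_bound (code_operation g) (code_operation f)"
  by standard (use assms code_operation_less bounds in auto)

lemma idempotent_iff_zero:
  assumes "a < q"
  shows "a \<oplus> a = a \<longleftrightarrow> a = \<zero>"
proof
  assume "a \<oplus> a = a"
  with assms show "a = \<zero>" using add.l_cancel_one[of a a] by (simp add: less_q)
qed (use assms in simp)

lemma wp_isomorphism_test:
  assumes f: "f \<in> algebras R n" and g: "g \<in> algebras R n"
    and r: "r 0 = q" "r 1 = n"
    and m: "m 0 = field_table q (\<lambda>a b. a \<oplus> b)" "m 1 = field_table q (\<lambda>a b. a \<otimes> b)"
      "m 2 = const_table n (struct_const R n f)" "m 3 = const_table n (struct_const R n g)"
  shows "wp size_bound isomorphism_test
    (\<lambda>r m. r 0 \<noteq> 0 \<longleftrightarrow> (\<exists>x<N. \<exists>v<N. bijection_graph N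
       (generated (q + 1) (code_operation g) (code_operation f) (x, v)))) r m"
proof -
  interpret pair_operations N "q + 1" size_bound "code_operation g" "code_operation f"
    by (rule pair_operations[OF f g])
  note bds = coordinate_space.bounds[OF coordinate_space_axioms, where n = n]
  have q: "q > 0" "q \<le> size_bound" using q_ge_2 order_trans[OF _ bds(1), of q] by simp_all
  have lt: "x < (q + 1) * N" if "x < n \<or> x < q" for x
    using that bds(6,7) n_less_N by linarith
  have idem: "\<forall>a<q. field_table q (\<lambda>a b. a \<oplus> b) (a * q + a) = a \<longleftrightarrow> a = \<zero>"
    by (simp add: field_table_nth idempotent_iff_zero)
  show ?thesis
    unfolding isomorphism_test_def
    apply (rule wp_Seq)
    apply (rule wp_frame[OF wp_set_sizes[where q = q and n = n]])
         apply (use r q bds in simp_all)[5]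
    subgoal for r1 m1
      apply (rule wp_Seq)
      apply (rule wp_frame[OF wp_fill_products[where q = q and N = N and L = "(q + 1) * N"]])
          apply (use r bds in simp_all)[4]
      subgoal for r2 m2
        apply (rule wp_Seq)
        apply (rule wp_frame[OF wp_fill_divisions[where q = q and N = N]])
             apply (use r q bds in simp_all)[5]
        subgoal for r3 m3
          apply (rule wp_Seq)
          apply (rule wp_frame[OF wp_fill_digits[where q = q and N = N and n = n]])
                apply (use r q bds lt in simp_all)[6]
          subgoal for r4 m4
            apply (rule wp_Seq)
            apply (rule wp_frame[OF wp_find_zero[where q = q and z = \<zero>]])
                 apply (use r m q bds idem zero_less_q lt in simp_all)[5]
            subgoal for r5 m5
              apply (subgoal_tac "tables r5 m5")
               prefer 2
              subgoal using r m by (simp add: tables_def decode_def)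
              apply (rule wp_Seq)
              apply (rule wp_frame[OF wp_fill_operations[OF g order_refl]])
                  apply assumption
                 apply (use m in simp_all)[3]
              subgoal for r6 m6
                apply (subgoal_tac "tables r6 m6")
                 prefer 2
                subgoal by (erule tables_cong) auto
                apply (rule wp_Seq)
                apply (rule wp_frame[OF wp_fill_operations[OF f order_refl]])
                    apply assumption
                   apply (use m in simp_all)[3]
                subgoal for r7 m7
                  apply (rule wp_search)
                  unfolding op_tables_def
                  apply (intro conjI allI impI)
                       apply (simp_all add: tables_def)[4]
                  subgoal for s a c
                    using mult_add_less[OF mult_add_less, of s "q + 1" a N c N]
                    by (simp add: operation_table_nth code_operation_def)
                  subgoal for s a c
                    using mult_add_less[OF mult_add_less, of s "q + 1" a N c N]
                    by (simp add: operation_table_nth code_operation_def)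
                  done
                done
              done
            done
          done
        done
      done
    done
qed

end

section \<open>Closures and isomorphisms\<close>

lemma card_eq_1_iff_ex1: "card {b. P b} = 1 \<longleftrightarrow> (\<exists>!b. P b)"
  by (simp add: card_1_singleton_iff Ex1_def set_eq_iff) blast

context coordinate_space
begin

lemma vec_simps:
  "i < n \<Longrightarrow> vadd R n u v i = u i \<oplus> v i" "i < n \<Longrightarrow> vscale R n a u i = a \<otimes> u i"
  by (simp_all add: vadd_def vscale_def)

definition generates where
  "generates f w \<longleftrightarrow> (\<forall>S. S \<subseteq> V \<longrightarrow> w \<in> S \<longrightarrow>
     (\<forall>s<q + 1. \<forall>u\<in>S. \<forall>v\<in>S. operation f s u v \<in> S) \<longrightarrow> S = V)"

lemma generatesD:
  assumes "generates f w" "S \<subseteq> V" "w \<in> S"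
    and "\<And>s u v. s < q + 1 \<Longrightarrow> u \<in> S \<Longrightarrow> v \<in> S \<Longrightarrow> operation f s u v \<in> S"
  shows "S = V"
  using assms unfolding generates_def by simp

text \<open>Taking \<open>s = 1\<close> gives additivity, \<open>s = - 1\<close> at the zero vector
  gives \<open>T 0 = 0\<close>, and then \<open>v = 0\<close> gives homogeneity.\<close>

lemma linear_on_vecsI:
  assumes TV: "\<And>u. u \<in> V \<Longrightarrow> T u \<in> V"
    and T: "\<And>s u v. s \<in> carrier R \<Longrightarrow> u \<in> V \<Longrightarrow> v \<in> V \<Longrightarrow>
      T (vadd R n (vscale R n s u) v) = vadd R n (vscale R n s (T u)) (T v)"
  shows "linear_on_vecs R n T"
proof -
  define z where "z = (\<lambda>i\<in>{..<n}. \<zero>)"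
  have zV: "z \<in> V" unfolding z_def vecs_def by auto
  have neg: "vadd R n (vscale R n (\<ominus> \<one>) u) u = z" if "u \<in> V" for u
    by (rule vecs_eqI[of _ R n])
      (use that zV vecs_memD[OF that] in \<open>auto simp: vec_simps z_def l_minus l_neg intro!: vadd_closed vscale_closed\<close>)
  have one: "vscale R n \<one> u = u" if "u \<in> V" for u
    by (rule vecs_eqI[of _ R n])
      (use that vecs_memD[OF that] in \<open>auto simp: vec_simps intro!: vscale_closed\<close>)
  have add0: "vadd R n u z = u" if "u \<in> V" for u
    by (rule vecs_eqI[of _ R n])
      (use that zV vecs_memD[OF that] in \<open>auto simp: vec_simps z_def intro!: vadd_closed\<close>)
  have "T (vadd R n u v) = vadd R n (T u) (T v)" if "u \<in> V" "v \<in> V" for u v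
    using T[OF one_closed that] one that TV by simp
  moreover have Tz: "T z = z"
    using T[of "\<ominus> \<one>" z z] neg[OF zV] neg[OF TV[OF zV]] zV by simp
  have "T (vscale R n a u) = vscale R n a (T u)" if "a \<in> carrier R" "u \<in> V" for a u
    using T[OF that zV] that TV Tz by (simp add: add0 vscale_closed)
  ultimately show ?thesis unfolding linear_on_vecs_def using TV by auto
qed

lemma linear_operation:
  assumes "linear_on_vecs R n T" "u \<in> V" "v \<in> V" "s < q"
  shows "T (operation g s u v) = operation f s (T u) (T v)"
  using assms vscale_closed[of s u n] unfolding linear_on_vecs_def operation_def by (simp add: less_q)

text \<open>The graph is closed under all \<open>q + 1\<close> operations, so the map it defines
  commutes with them: the first \<open>q\<close> say that it is linear, the last that it is
  multiplicative. Nothing is assumed about generation, so acceptance is always right.\<close>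

lemma bijection_graph_isomorphic:
  assumes f: "f \<in> algebras R n" and g: "g \<in> algebras R n" and xv: "x < N" "v < N"
    and bij: "bijection_graph N (generated (q + 1) (code_operation g) (code_operation f) (x, v))"
  shows "alg_isomorphic R n f g"
proof -
  interpret pair_operations N "q + 1" size_bound "code_operation g" "code_operation f"
    by (rule pair_operations[OF f g])
  let ?A = "G (x, v)"
  have sub: "?A \<subseteq> {..<N} \<times> {..<N}" using xv by (intro generated_subset) auto
  note ex1 = bij[unfolded bijection_graph_def card_eq_1_iff_ex1, rule_format, THEN conjunct1]
    bij[unfolded bijection_graph_def card_eq_1_iff_ex1, rule_format, THEN conjunct2]
  define \<pi> where "\<pi> a = (THE b. b < N \<and> (a, b) \<in> ?A)" for a
  have \<pi>: "\<pi> a < N" "(a, \<pi> a) \<in> ?A" if "a < N" for a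
    using theI'[OF ex1(1)[OF that]] unfolding \<pi>_def by (rule conjunct1, rule conjunct2)
  have \<pi>_eq: "\<pi> a = b" if "(a, b) \<in> ?A" for a b
    unfolding \<pi>_def by (rule the1_equality[OF ex1(1)]) (use that sub in auto)
  define T where "T u = decode q n (\<pi> (encode q u n))" for u
  have TV: "T u \<in> V" for u unfolding T_def by (rule decode_closed)
  have \<pi>_op: "\<pi> (code_operation g s a c) = code_operation f s (\<pi> a) (\<pi> c)"
    if "s < q + 1" "a < N" "c < N" for s a c
    by (intro \<pi>_eq generated.step that \<pi>)
  have T_op: "T (operation g s u w) = operation f s (T u) (T w)"
    if "s < q + 1" "u \<in> V" "w \<in> V" for s u w
  proof -
    have "operation g s u w \<in> V" "operation f s (T u) (T w) \<in> V"
      using operation_closed f g that TV by auto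
    moreover have "\<pi> (code_operation g s (encode q u n) (encode q w n))
        = code_operation f s (\<pi> (encode q u n)) (\<pi> (encode q w n))"
      using that by (intro \<pi>_op encode_less_N)
    ultimately show ?thesis
      using that unfolding T_def code_operation_def by (simp add: decode_encode)
  qed
  have "linear_on_vecs R n T"
  proof (rule linear_on_vecsI[OF TV])
    fix s u w assume "s \<in> carrier R" "u \<in> V" "w \<in> V"
    then show "T (vadd R n (vscale R n s u) w) = vadd R n (vscale R n s (T u)) (T w)"
      using T_op[of s u w] by (simp add: less_q operation_def)
  qed
  moreover have "bij_betw T V V"
  proof -
    have "inj_on \<pi> {..<N}"
    proof (rule inj_onI)
      fix a c assume "a \<in> {..<N}" "c \<in> {..<N}" "\<pi> a = \<pi> c"
      then show "a = c" using ex1(2)[of "\<pi> a"] \<pi>[of a] \<pi>[of c] by (metis lessThan_iff)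
    qed
    moreover have "inj_on (\<lambda>u. encode q u n) V"
      by (rule inj_on_inverseI[of _ "decode q n"]) (rule decode_encode)
    moreover have "inj_on (decode q n) {..<N}" using bij_betw_decode by (simp add: bij_betw_def)
    ultimately have "inj_on T V"
      unfolding T_def inj_on_def using encode_less_N \<pi> by simp
    moreover have "T ` V \<subseteq> V" using TV by blast
    ultimately show ?thesis
      unfolding bij_betw_def using endo_inj_surj[of V T] finite_vecs[of R n] by (simp add: carrier)
  qed
  moreover have "f (T u) (T w) = T (g u w)" if "u \<in> V" "w \<in> V" for u w
    using T_op[of q u w] that by (simp add: operation_def)
  ultimately show ?thesis unfolding alg_isomorphic_def GL_def by blast
qed

text \<open>Start from the pair of \<open>w\<close> and its preimage. The graph of \<open>T\<close>
  is closed, so it contains the closure; conversely, the \<open>u\<close> whose pair with their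
  preimage is reached form a set closed under \<open>f\<close> that contains \<open>w\<close>, hence
  all of \<open>V\<close>.\<close>

lemma isomorphic_bijection_graph:
  assumes f: "f \<in> algebras R n" and g: "g \<in> algebras R n" and w: "w \<in> V" "generates f w"
    and iso: "alg_isomorphic R n f g"
  shows "\<exists>x<N. \<exists>v<N. bijection_graph N (generated (q + 1) (code_operation g) (code_operation f) (x, v))"
proof -
  obtain T where T: "linear_on_vecs R n T" "bij_betw T V V"
    and Tg: "\<And>u v. u \<in> V \<Longrightarrow> v \<in> V \<Longrightarrow> f (T u) (T v) = T (g u v)"
    using iso unfolding alg_isomorphic_def GL_def by blast
  have TV: "u \<in> V \<Longrightarrow> T u \<in> V" for u using T(1) unfolding linear_on_vecs_def by blast
  have T_op: "T (operation g s u v) = operation f s (T u) (T v)" if "u \<in> V" "v \<in> V" for s u v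
    using linear_operation[OF T(1) that] Tg[OF that] by (cases "s < q") (simp_all add: operation_def)
  define T' where "T' = the_inv_into V T"
  have T': "T' u \<in> V" "T (T' u) = u" if "u \<in> V" for u
    using the_inv_into_into[of T V u V] f_the_inv_into_f[of T V u] T(2) that
    unfolding T'_def bij_betw_def by auto
  have T'_T: "T' (T u) = u" if "u \<in> V" for u
    using the_inv_into_f_f[of T V u] T(2) that unfolding T'_def bij_betw_def by auto
  interpret pair_operations N "q + 1" size_bound "code_operation g" "code_operation f"
    by (rule pair_operations[OF f g])
  let ?e = "\<lambda>u. encode q u n"
  let ?A = "G (?e (T' w), ?e w)"
  have step: "(?e (operation g s u v), ?e (operation f s u' v')) \<in> ?A"
    if "(?e u, ?e u') \<in> ?A" "(?e v, ?e v') \<in> ?A" "s < q + 1"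
      "u \<in> V" "v \<in> V" "u' \<in> V" "v' \<in> V" for s u v u' v'
    using generated.step[OF that(1-3)] that(4-) by (simp add: code_operation_def decode_encode)
  have graph: "decode q n b = T (decode q n a)" if "(a, b) \<in> ?A" for a b
    using that
  proof (induction "(a, b)" arbitrary: a b)
    case base
    then show ?case using T' w by (simp add: decode_encode)
  next
    case (step a b c d s)
    then show ?case
      by (simp add: code_operation_def decode_encode operation_closed f g decode_closed T_op TV)
  qed
  have all: "(?e (T' u), ?e u) \<in> ?A" if "u \<in> V" for u
  proof -
    let ?S = "{u \<in> V. (?e (T' u), ?e u) \<in> ?A}"
    have op: "operation f s u v \<in> ?S" if "s < q + 1" "u \<in> ?S" "v \<in> ?S" for s u v
    proof -
      have uv: "u \<in> V" "v \<in> V" using that by auto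
      have "T' (operation f s u v) = operation g s (T' u) (T' v)"
        using T'_T[of "operation g s (T' u) (T' v)"] T_op[OF T'(1)[OF uv(1)] T'(1)[OF uv(2)]]
          T' uv operation_closed[OF g] by simp
      moreover have "(?e (operation g s (T' u) (T' v)), ?e (operation f s u v)) \<in> ?A"
        using that T' uv by (intro step) auto
      ultimately show ?thesis using operation_closed[OF f uv] by simp
    qed
    have "w \<in> ?S" using w by (simp add: generated.base)
    then have "?S = V" by (rule generatesD[OF w(2) Collect_restrict _ op])
    with that show ?thesis by blast
  qed
  have "bijection_graph N ?A"
    unfolding bijection_graph_def
  proof (intro allI impI conjI)
    fix a assume a: "a < N"
    have "{b. b < N \<and> (a, b) \<in> ?A} = {?e (T (decode q n a))}"
    proof (intro subset_antisym subsetI)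
      fix b assume "b \<in> {b. b < N \<and> (a, b) \<in> ?A}"
      then show "b \<in> {?e (T (decode q n a))}" using graph[of a b] encode_decode[of b q n] by simp
    next
      fix b assume "b \<in> {?e (T (decode q n a))}"
      then show "b \<in> {b. b < N \<and> (a, b) \<in> ?A}"
        using all[OF TV[OF decode_closed[of a]]] a
        by (simp add: T'_T decode_closed encode_decode encode_less_N TV)
    qed
    then show "card {b. b < N \<and> (a, b) \<in> ?A} = 1" by simp
    have "{b. b < N \<and> (b, a) \<in> ?A} = {?e (T' (decode q n a))}"
    proof (intro subset_antisym subsetI)
      fix b assume "b \<in> {b. b < N \<and> (b, a) \<in> ?A}"
      then show "b \<in> {?e (T' (decode q n a))}"
        using graph[of b a] encode_decode[of b q n] by (simp add: T'_T decode_closed)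
    next
      fix b assume "b \<in> {?e (T' (decode q n a))}"
      then show "b \<in> {b. b < N \<and> (b, a) \<in> ?A}"
        using all[OF decode_closed[of a]] a T'[OF decode_closed[of a]]
        by (simp add: encode_decode encode_less_N)
    qed
    then show "card {b. b < N \<and> (b, a) \<in> ?A} = 1" by simp
  qed
  then show ?thesis
    by (intro exI[of _ "?e (T' w)"] exI[of _ "?e w"] conjI encode_less_N T' w)
qed

end

section \<open>Subspaces preserved by an algebra\<close>

context coordinate_space
begin

definition subspace where
  "subspace S \<longleftrightarrow> S \<subseteq> V \<and> S \<noteq> {} \<and>
     (\<forall>s\<in>carrier R. \<forall>u\<in>S. \<forall>v\<in>S. vadd R n (vscale R n s u) v \<in> S)"

definition zero_vec where "zero_vec = (\<lambda>i\<in>{..<n}. \<zero>)"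

lemma zero_vec_closed: "zero_vec \<in> V"
  unfolding zero_vec_def vecs_def by auto

context
  fixes S assumes S: "subspace S"
begin

lemma subspace_in_V: "u \<in> S \<Longrightarrow> u \<in> V"
  using S unfolding subspace_def by blast

lemma subspace_carrier: "u \<in> S \<Longrightarrow> i < n \<Longrightarrow> u i \<in> carrier R"
  using vecs_memD[OF subspace_in_V] .

lemma subspace_combination: "s \<in> carrier R \<Longrightarrow> u \<in> S \<Longrightarrow> v \<in> S \<Longrightarrow> vadd R n (vscale R n s u) v \<in> S"
  using S unfolding subspace_def by simp

lemma subspace_zero: "zero_vec \<in> S"
proof -
  obtain u where u: "u \<in> S" using S unfolding subspace_def by auto
  note uV = subspace_in_V[OF u]
  have "vadd R n (vscale R n (\<ominus> \<one>) u) u = zero_vec"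
    by (rule vecs_eqI[of _ R n])
      (use uV zero_vec_closed vecs_memD[OF uV] in
        \<open>auto simp: vec_simps zero_vec_def l_minus l_neg intro!: vadd_closed vscale_closed\<close>)
  with subspace_combination[OF _ u u, of "\<ominus> \<one>"] show ?thesis by simp
qed

end

text \<open>
  \<open>P\<close> is an information set of \<open>S\<close>: restriction to \<open>P\<close> is an isomorphism from \<open>S\<close> onto the
  functions on \<open>P\<close>, and the vectors \<open>b\<close> form the dual basis. Minimality of an injective restriction
  yields such a \<open>P\<close> without any dimension theory.
\<close>

definition coordinates_on where
  "coordinates_on P S \<longleftrightarrow> P \<subseteq> {..<n} \<and>
     (\<forall>u\<in>S. \<forall>v\<in>S. (\<forall>i\<in>P. u i = v i) \<longrightarrow> u = v) \<and>
     (\<forall>i\<in>P. \<exists>b\<in>S. b i = \<one> \<and> (\<forall>j\<in>P - {i}. b j = \<zero>))"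

lemma coordinates_on_eq:
  assumes "coordinates_on P S" "u \<in> S" "v \<in> S" "\<And>i. i \<in> P \<Longrightarrow> u i = v i"
  shows "u = v"
  using assms unfolding coordinates_on_def by simp

lemma coordinates_on_less: "coordinates_on P S \<Longrightarrow> i \<in> P \<Longrightarrow> i < n"
  unfolding coordinates_on_def by auto

text \<open>If \<open>P\<close> is minimal, removing \<open>i\<close> produces two vectors of
  \<open>S\<close> that agree on the rest of \<open>P\<close> but differ at \<open>i\<close>; their
  difference, divided by its entry at \<open>i\<close>, is the dual vector.\<close>

lemma ex_coordinates_on:
  assumes S: "subspace S"
  shows "\<exists>P. coordinates_on P S"
proof -
  define inj where "inj P \<longleftrightarrow> P \<subseteq> {..<n} \<and> (\<forall>u\<in>S. \<forall>v\<in>S. (\<forall>i\<in>P. u i = v i) \<longrightarrow> u = v)" for P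
  have "inj {..<n}"
    unfolding inj_def using vecs_eqI[of _ R n] subspace_in_V[OF S] by simp
  then obtain P where P: "inj P" and min: "\<And>Q. inj Q \<Longrightarrow> card P \<le> card Q"
    using ex_has_least_nat[of inj _ card] by blast
  have Pn: "P \<subseteq> {..<n}" using P unfolding inj_def by simp
  have "\<exists>b\<in>S. b i = \<one> \<and> (\<forall>j\<in>P - {i}. b j = \<zero>)" if i: "i \<in> P" for i
  proof -
    have "card (P - {i}) < card P"
      using i Pn finite_subset by (intro card_Diff1_less) auto
    then have "\<not> inj (P - {i})" using min[of "P - {i}"] by auto
    then obtain u v where uv: "u \<in> S" "v \<in> S" "\<And>j. j \<in> P - {i} \<Longrightarrow> u j = v j" "u \<noteq> v"
      using Pn unfolding inj_def by auto
    have "u i \<noteq> v i"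
    proof
      assume "u i = v i"
      then have "\<forall>j\<in>P. u j = v j" using uv(3) by auto
      then show False using P uv unfolding inj_def by simp
    qed
    have in_n: "j < n" if "j \<in> P" for j using Pn that by auto
    note c = subspace_carrier[OF S uv(1) in_n] subspace_carrier[OF S uv(2) in_n]
    let ?d = "vadd R n (vscale R n (\<ominus> \<one>) v) u"
    have d: "?d \<in> S" using subspace_combination[OF S _ uv(2,1)] by simp
    have dj: "?d j = u j \<ominus> v j" if "j \<in> P" for j
      using c[OF that] in_n[OF that] by (simp add: vec_simps l_minus minus_eq a_comm)
    have "?d i \<noteq> \<zero>" 
      using dj[OF i] \<open>u i \<noteq> v i\<close> c[OF i] minus_equality[of "u i" "\<ominus> v i"] by (auto simp: minus_eq)
    then have unit: "?d i \<in> Units R"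
      using subspace_carrier[OF S d in_n[OF i]] by (simp add: field_Units)
    \<comment> \<open>Adding \<open>zero_vec\<close> brings the scalar multiple into the form
      \<open>s u + v\<close> under which subspaces are closed.\<close>
    let ?b = "vadd R n (vscale R n (inv (?d i)) ?d) zero_vec"
    have inv: "inv (?d i) \<in> carrier R" using unit by simp
    have b: "?b j = inv (?d i) \<otimes> ?d j" if "j \<in> P" for j
      using in_n[OF that] inv subspace_carrier[OF S d in_n[OF that]]
      by (subst vec_simps(1)) (simp_all add: vec_simps(2) zero_vec_def)
    have "?b \<in> S" by (rule subspace_combination[OF S inv d subspace_zero[OF S]])
    moreover have "?b i = \<one>" using b[OF i] unit by simp
    moreover have "?b j = \<zero>" if "j \<in> P - {i}" for j
    proof -
      have "j \<in> P" using that by blast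
      then have "?d j = \<zero>" using dj[of j] uv(3)[OF that] c[of j] by (simp add: minus_eq r_neg)
      with b[OF \<open>j \<in> P\<close>] inv show ?thesis by simp
    qed
    ultimately show ?thesis by blast
  qed
  with P show ?thesis unfolding inj_def coordinates_on_def by blast
qed

text \<open>The combination of the common dual vectors with coefficients \<open>v i\<close> agrees
  with \<open>v\<close> on \<open>P\<close>, hence equals \<open>v\<close>. It is built one
  coordinate at a time.\<close>

lemma subspace_subset:
  assumes S: "subspace S" "coordinates_on P S" and S': "subspace S'"
    and b: "\<And>i. i \<in> P \<Longrightarrow> \<exists>b\<in>S \<inter> S'. b i = \<one> \<and> (\<forall>j\<in>P - {i}. b j = \<zero>)"
  shows "S \<subseteq> S'"
proof
  fix v assume v: "v \<in> S"
  have P: "finite P" "\<And>i. i \<in> P \<Longrightarrow> i < n"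
    using S(2) finite_subset unfolding coordinates_on_def by auto
  have "\<exists>w\<in>S \<inter> S'. (\<forall>i\<in>Q. w i = v i) \<and> (\<forall>i\<in>P - Q. w i = \<zero>)" if "Q \<subseteq> P" for Q
    using finite_subset[OF that P(1)] that
  proof (induction Q)
    case empty
    have "zero_vec \<in> S \<inter> S'" using subspace_zero S(1) S' by simp
    then show ?case by (rule bexI[rotated]) (use P in \<open>auto simp: zero_vec_def\<close>)
  next
    case (insert i Q)
    then have i: "i \<in> P" by simp
    obtain w where w: "w \<in> S" "w \<in> S'" "\<forall>j\<in>Q. w j = v j" "\<forall>j\<in>P - Q. w j = \<zero>"
      using insert by auto
    obtain b where b: "b \<in> S" "b \<in> S'" "b i = \<one>" "\<forall>j\<in>P - {i}. b j = \<zero>"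
      using b[OF i] by auto
    have vi: "v i \<in> carrier R" by (rule subspace_carrier[OF S(1) v P(2)[OF i]])
    let ?w = "vadd R n (vscale R n (v i) b) w"
    have "?w \<in> S \<inter> S'"
      using subspace_combination[OF S(1) vi b(1) w(1)] subspace_combination[OF S' vi b(2) w(2)] by simp
    moreover have "?w j = v j" if "j \<in> insert i Q" for j
    proof (cases "j = i")
      case True
      have "w i = \<zero>" using w(4) i insert.hyps by simp
      with True b(3) vi P(2)[OF i] show ?thesis by (simp add: vec_simps)
    next
      case False
      then have "j \<in> P" "j \<in> Q" using that insert.prems by auto
      then show ?thesis
        using b(4) w(3) vi False P(2)[of j] subspace_carrier[OF S(1) v, of j] by (simp add: vec_simps)
    qed
    moreover have "?w j = \<zero>" if "j \<in> P - insert i Q" for j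
      using that b(4) w(4) vi P(2)[of j] by (simp add: vec_simps)
    ultimately show ?case by blast
  qed
  from this[OF order_refl] obtain w where w: "w \<in> S" "w \<in> S'" "\<And>i. i \<in> P \<Longrightarrow> w i = v i"
    by auto
  have "w = v" by (rule coordinates_on_eq[OF S(2) w(1) v w(3)])
  with w(2) show "v \<in> S'" by simp
qed

text \<open>The dual vectors form a matrix with the identity in the columns \<open>P\<close>, like a
  reduced echelon form. The remaining \<open>card P * (n - card P)\<close> entries determine the
  subspace.\<close>

lemma card_subspaces:
  assumes P: "P \<subseteq> {..<n}"
  shows "finite {S. subspace S \<and> coordinates_on P S}"
    and "card {S. subspace S \<and> coordinates_on P S} \<le> q ^ (card P * (n - card P))"
proof -
  let ?D = "{S. subspace S \<and> coordinates_on P S}" and ?I = "P \<times> ({..<n} - P)"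
  define b where "b S i = (SOME b. b \<in> S \<and> b i = \<one> \<and> (\<forall>j\<in>P - {i}. b j = \<zero>))" for S i
  have b: "b S i \<in> S" "b S i i = \<one>" "\<And>j. j \<in> P - {i} \<Longrightarrow> b S i j = \<zero>" if "S \<in> ?D" "i \<in> P" for S i
  proof -
    have "\<exists>b. b \<in> S \<and> b i = \<one> \<and> (\<forall>j\<in>P - {i}. b j = \<zero>)"
      using that unfolding coordinates_on_def by blast
    from someI_ex[OF this] show "b S i \<in> S" "b S i i = \<one>" "\<And>j. j \<in> P - {i} \<Longrightarrow> b S i j = \<zero>"
      unfolding b_def by auto
  qed
  define M where "M S = (\<lambda>(i, k)\<in>?I. b S i k)" for S
  have M: "M S \<in> ?I \<rightarrow>\<^sub>E carrier R" if "S \<in> ?D" for S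
    unfolding M_def using b(1)[OF that] that by (auto intro: subspace_carrier)
  have sub: "S \<subseteq> S'" if S: "S \<in> ?D" and S': "S' \<in> ?D" and eq: "M S = M S'" for S S'
  proof (rule subspace_subset)
    show "subspace S" "coordinates_on P S" "subspace S'" using S S' by auto
    fix i assume i: "i \<in> P"
    have "b S i = b S' i"
    proof (rule vecs_eqI[of _ R n])
      show "b S i \<in> V" "b S' i \<in> V" using subspace_in_V b(1) i S S' by blast+
      fix k assume k: "k < n"
      show "b S i k = b S' i k"
      proof (cases "k \<in> P")
        case True
        then show ?thesis
          using b(2,3)[OF S i] b(2,3)[OF S' i] by (cases "k = i") simp_all
      next
        case False
        then show ?thesis using fun_cong[OF eq, of "(i, k)"] i k by (simp add: M_def)
      qed
    qed
    then show "\<exists>b\<in>S \<inter> S'. b i = \<one> \<and> (\<forall>j\<in>P - {i}. b j = \<zero>)"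
      using b[OF S i] b(1)[OF S' i] by (intro bexI[of _ "b S i"]) auto
  qed
  have inj: "inj_on M ?D" by (rule inj_onI, rule subset_antisym) (rule sub; simp)+
  have fin: "finite (?I \<rightarrow>\<^sub>E carrier R)"
    using P finite_subset by (intro finite_PiE) (auto simp: carrier)
  have img: "M ` ?D \<subseteq> ?I \<rightarrow>\<^sub>E carrier R" by (rule image_subsetI) (rule M)
  show "finite ?D" using inj_on_finite[OF inj img fin] .
  have "card ?D \<le> card (?I \<rightarrow>\<^sub>E carrier R)" using card_inj_on_le[OF inj img fin] .
  also have "\<dots> = q ^ card ?I"
    using P finite_subset[OF P] by (subst card_PiE) (auto simp: carrier)
  also have "card ?I = card P * (n - card P)"
    using P finite_subset[OF P] by (simp add: card_cartesian_product card_Diff_subset)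
  finally show "card ?D \<le> q ^ (card P * (n - card P))" .
qed

text \<open>The difference of \<open>b\<close> and the unit vector vanishes on \<open>P\<close>, so
  both maps agree on it by \<open>off\<close>; they agree on \<open>b\<close>, hence on the unit
  vector.\<close>

lemma linear_agree_unit_vec:
  assumes L: "linear_on_vecs R n L" "linear_on_vecs R n L'"
    and off: "\<And>l. l < n \<Longrightarrow> l \<notin> P \<Longrightarrow> L (unit_vec R n l) = L' (unit_vec R n l)"
    and b: "b \<in> V" "L b = L' b" "b i = \<one>" "\<And>j. j \<in> P - {i} \<Longrightarrow> b j = \<zero>" and i: "i < n"
  shows "L (unit_vec R n i) = L' (unit_vec R n i)"
proof -
  let ?e = "unit_vec R n i"
  have LV: "L u \<in> V" "L' u \<in> V" if "u \<in> V" for u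
    using L that unfolding linear_on_vecs_def by blast+
  note c = vecs_memD[OF LV(1)[OF unit_vec_closed]] vecs_memD[OF LV(2)[OF unit_vec_closed]]
  define r where "r = vadd R n (vscale R n (\<ominus> \<one>) ?e) b"
  have r: "r \<in> V"
    unfolding r_def by (intro vadd_closed vscale_closed a_inv_closed one_closed b(1) unit_vec_closed)
  have r0: "r l = \<zero>" if "l \<in> P" "l < n" for l
    using that b(3,4) i unfolding r_def by (cases "l = i") (simp_all add: vec_simps unit_vec_def l_neg)
  have Lr: "L r = L' r"
  proof (rule vecs_eqI[of _ R n])
    fix k assume k: "k < n"
    have "L r k = (\<Oplus>l\<in>{..<n}. r l \<otimes> L (unit_vec R n l) k)" by (rule linear_expansion[OF L(1) r k])
    also have "\<dots> = (\<Oplus>l\<in>{..<n}. r l \<otimes> L' (unit_vec R n l) k)"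
    proof (rule finsum_cong')
      fix l assume l: "l \<in> {..<n}"
      show "r l \<otimes> L (unit_vec R n l) k = r l \<otimes> L' (unit_vec R n l) k"
        using l off[of l] r0[of l] c[OF k] by (cases "l \<in> P") simp_all
    qed (use vecs_memD[OF r] c[OF k] in auto)
    also have "\<dots> = L' r k" by (rule linear_expansion[OF L(2) r k, symmetric])
    finally show "L r k = L' r k" .
  qed (use LV r in auto)
  have e: "?e = vadd R n (vscale R n (\<ominus> \<one>) r) b"
  proof (rule vecs_eqI[of _ R n])
    show "vadd R n (vscale R n (\<ominus> \<one>) r) b \<in> V"
      by (intro vadd_closed vscale_closed a_inv_closed one_closed b(1) r)
    fix k assume k: "k < n"
    note kc = vecs_memD[OF b(1) k] vecs_memD[OF unit_vec_closed k, of i]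
    then show "?e k = vadd R n (vscale R n (\<ominus> \<one>) r) b k"
      using k unfolding r_def by (simp add: vec_simps l_minus minus_add a_assoc l_neg)
  qed (rule unit_vec_closed)
  have "T ?e = vadd R n (vscale R n (\<ominus> \<one>) (T r)) (T b)" if "linear_on_vecs R n T" for T
    using that r b(1) vscale_closed[OF _ r, of "\<ominus> \<one>"] unfolding linear_on_vecs_def by (subst e) simp
  with L Lr b(2) show ?thesis by simp
qed

section \<open>Counting the algebras that preserve a subspace\<close>

definition closed_under where
  "closed_under f S \<longleftrightarrow> (\<forall>u\<in>S. \<forall>v\<in>S. f u v \<in> S)"

lemma finite_algebras: "finite (algebras R n)"
  and card_algebras: "card (algebras R n) = q ^ (n * n * n)"
proof -
  note bij = bij_betw_struct_const[of n]
  have "finite ({..<n} \<times> {..<n} \<times> {..<n} \<rightarrow>\<^sub>E carrier R)"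
    by (intro finite_PiE) (auto simp: carrier)
  then show "finite (algebras R n)" using bij_betw_finite[OF bij] by blast
  show "card (algebras R n) = q ^ (n * n * n)"
    using bij_betw_same_card[OF bij] by (simp add: card_PiE card_cartesian_product carrier mult.assoc)
qed

text \<open>
  For \<open>i, j \<in> P\<close> with dual vectors \<open>b\<^sub>i, b\<^sub>j\<close>, the product of \<open>b\<^sub>i\<close> and \<open>b\<^sub>j\<close> differs from that of
  \<open>e\<^sub>i\<close> and \<open>e\<^sub>j\<close> only by products with a factor outside \<open>P\<close>, and it lies in \<open>S\<close>, so its coordinates
  in \<open>P\<close> determine it. The constants indexed by \<open>P \<times> P \<times> -P\<close> are thus determined by the others.
\<close>

lemma card_closed_algebras:
  assumes S: "subspace S" "coordinates_on P S"
  shows "card {f \<in> algebras R n. closed_under f S} \<le> q ^ (n * n * n - card P * card P * (n - card P))"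
proof -
  let ?D = "{f \<in> algebras R n. closed_under f S}"
  let ?X = "{..<n} \<times> {..<n} \<times> {..<n}" and ?Y = "P \<times> P \<times> ({..<n} - P)"
  have P: "P \<subseteq> {..<n}" "finite P" using S(2) finite_subset unfolding coordinates_on_def by auto
  define \<rho> where "\<rho> f = restrict (struct_const R n f) (?X - ?Y)" for f
  have img: "\<rho> ` ?D \<subseteq> (?X - ?Y) \<rightarrow>\<^sub>E carrier R"
  proof -
    have "\<rho> f \<in> (?X - ?Y) \<rightarrow>\<^sub>E carrier R" if "f \<in> algebras R n" for f
    proof -
      have "struct_const R n f \<in> ?X \<rightarrow>\<^sub>E carrier R"
        by (rule bij_betwE[OF bij_betw_struct_const, rule_format, OF that])
      then show ?thesis unfolding \<rho>_def by (auto simp: PiE_def Pi_def)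
    qed
    then show ?thesis by (intro image_subsetI) simp
  qed
  have inj: "inj_on \<rho> ?D"
  proof (rule inj_onI)
    fix f f' assume "f \<in> ?D" "f' \<in> ?D" and eq: "\<rho> f = \<rho> f'"
    then have f: "f \<in> algebras R n" "f' \<in> algebras R n"
      and cl: "\<And>u v. u \<in> S \<Longrightarrow> v \<in> S \<Longrightarrow> f u v \<in> S" "\<And>u v. u \<in> S \<Longrightarrow> v \<in> S \<Longrightarrow> f' u v \<in> S"
      unfolding closed_under_def by auto
    let ?e = "unit_vec R n"
    have lin: "linear_on_vecs R n (h u)" "linear_on_vecs R n (\<lambda>w. h w u)"
      if "h \<in> algebras R n" "u \<in> V" for h u
      using that unfolding algebras_def by auto
    have sc: "struct_const R n h (i, j, k) = h (?e i) (?e j) k" if "i < n" "j < n" "k < n" for h i j k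
      using that by (simp add: struct_const_def)
    have c_eq: "struct_const R n f (i, j, k) = struct_const R n f' (i, j, k)"
      if "i < n" "j < n" "k < n" "i \<notin> P \<or> j \<notin> P \<or> k \<in> P" for i j k
      using fun_cong[OF eq, of "(i, j, k)"] that by (auto simp: \<rho>_def)
    have coord: "f u v k = f' u v k" if "u \<in> V" "v \<in> V" "k \<in> P" for u v k
    proof -
      have k: "k < n" using that P by auto
      have cc: "struct_const R n f' (i, j, k) \<in> carrier R" if "i < n" "j < n" for i j
        using sc[OF that k] vecs_memD[OF algebra_closed[OF f(2) unit_vec_closed unit_vec_closed] k] by simp
      note uv = vecs_memD[OF that(1)] vecs_memD[OF that(2)]
      have inner: "(\<Oplus>j\<in>{..<n}. v j \<otimes> struct_const R n f (i, j, k))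
          = (\<Oplus>j\<in>{..<n}. v j \<otimes> struct_const R n f' (i, j, k))" if "i < n" for i
        by (rule finsum_cong') (use that k \<open>k \<in> P\<close> c_eq cc uv in auto)
      show ?thesis
        unfolding algebra_expansion[OF f(1) that(1,2) k] algebra_expansion[OF f(2) that(1,2) k]
        by (rule finsum_cong') (use inner cc uv in \<open>auto intro!: finsum_closed\<close>)
    qed
    have on_S: "f u v = f' u v" if "u \<in> S" "v \<in> S" for u v
      using coordinates_on_eq[OF S(2) cl(1)[OF that] cl(2)[OF that]] coord subspace_in_V[OF S(1)] that by simp
    have off: "f (?e i) (?e j) = f' (?e i) (?e j)" if "i < n" "j < n" "i \<notin> P \<or> j \<notin> P" for i j
    proof (rule vecs_eqI[of _ R n])
      fix k assume "k < n"
      then show "f (?e i) (?e j) k = f' (?e i) (?e j) k"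
        using c_eq[of i j k] that sc by auto
    qed (use f algebra_closed unit_vec_closed in auto)
    have off1: "f (?e i) v = f' (?e i) v" if "i < n" "i \<notin> P" "v \<in> V" for i v
      by (rule linear_on_vecs_eqI[OF lin(1)[OF f(1) unit_vec_closed] lin(1)[OF f(2) unit_vec_closed] off])
        (use that in auto)
    have basis: "f (?e i) (?e j) = f' (?e i) (?e j)" if ij: "i < n" "j < n" for i j
    proof (cases "i \<in> P \<and> j \<in> P")
      case True
      obtain b where b: "b \<in> S" "b i = \<one>" "\<And>l. l \<in> P - {i} \<Longrightarrow> b l = \<zero>"
        using S(2) True unfolding coordinates_on_def by auto
      obtain d where d: "d \<in> S" "d j = \<one>" "\<And>l. l \<in> P - {j} \<Longrightarrow> d l = \<zero>"
        using S(2) True unfolding coordinates_on_def by auto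
      note bV = subspace_in_V[OF S(1) b(1)] and dV = subspace_in_V[OF S(1) d(1)]
      \<comment> \<open>Dual vectors are traded for unit vectors one argument at a time: the left
        one here, with \<open>d\<close> kept fixed, the right one below.\<close>
      have fd: "f (?e i) d = f' (?e i) d"
        by (rule linear_agree_unit_vec[OF lin(2)[OF f(1) dV] lin(2)[OF f(2) dV] off1[OF _ _ dV] bV
              on_S[OF b(1) d(1)] b(2,3) ij(1)])
      have off_i: "f (?e i) (?e l) = f' (?e i) (?e l)" if "l < n" "l \<notin> P" for l
        using off[OF ij(1)] that by simp
      show ?thesis
        by (rule linear_agree_unit_vec[OF lin(1)[OF f(1) unit_vec_closed] lin(1)[OF f(2) unit_vec_closed]
              off_i dV fd d(2,3) ij(2)])
    next
      case False
      then show ?thesis using off[OF ij] by simp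
    qed
    have "struct_const R n f = struct_const R n f'"
      unfolding struct_const_def by (rule restrict_ext) (use basis in auto)
    then show "f = f'"
      by (rule inj_onD[OF bij_betw_imp_inj_on[OF bij_betw_struct_const] _ f])
  qed
  have fin: "finite ((?X - ?Y) \<rightarrow>\<^sub>E carrier R)" by (intro finite_PiE) (auto simp: carrier)
  have "card ?D \<le> card ((?X - ?Y) \<rightarrow>\<^sub>E carrier R)" by (rule card_inj_on_le[OF inj img fin])
  also have "\<dots> = q ^ card (?X - ?Y)" by (subst card_PiE) (auto simp: carrier)
  also have "card (?X - ?Y) = card ?X - card ?Y"
    by (rule card_Diff_subset) (use P in auto)
  also have "\<dots> = n * n * n - card P * card P * (n - card P)"
    using P by (simp add: card_cartesian_product card_Diff_subset mult.assoc)
  finally show ?thesis .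
qed

section \<open>Union bound over the preserved subspaces\<close>

lemma exponent_bound:
  fixes k :: nat
  assumes "2 \<le> k" "k < n"
  shows "k * (n - k) + 2 * (n - 2) \<le> k * k * (n - k)" "k * k * (n - k) \<le> n * n * n"
proof -
  \<comment> \<open>With \<open>n - k = j + 1\<close> the first claim reduces to
    \<open>2 * (i + j + 1) \<le> (i + 2) * (i + 1) * (j + 1)\<close>, which holds term by term after
    expansion.\<close>
  obtain i where i: "k = i + 2" using assms(1) by (metis le_add_diff_inverse2)
  obtain j where j: "n = i + 2 + (j + 1)"
    using assms(2) i by (metis add.assoc less_iff_Suc_add Suc_eq_plus1 add_Suc_right)
  show "k * (n - k) + 2 * (n - 2) \<le> k * k * (n - k)"
    unfolding i j by (simp add: algebra_simps)
  show "k * k * (n - k) \<le> n * n * n"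
    using assms by (intro mult_mono) auto
qed

lemma card_not_generated_from:
  assumes n: "n \<ge> 5"
  shows "card {f \<in> algebras R n. \<not> generates f (unit_vec R n 0)} * q ^ (n - 5) \<le> q ^ (n * n * n)"
proof -
  let ?e = "unit_vec R n 0"
  have e0: "?e 0 = \<one>" and ei: "\<And>i. 0 < i \<Longrightarrow> i < n \<Longrightarrow> ?e i = \<zero>"
    using n by (simp_all add: unit_vec_def)
  define A where "A P = {S. (subspace S \<and> coordinates_on P S) \<and> ?e \<in> S \<and> S \<noteq> V}" for P
  define C where "C S = {f \<in> algebras R n. closed_under f S}" for S
  have finA: "finite (A P)" and cardA: "card (A P) \<le> q ^ (card P * (n - card P))" if "P \<subseteq> {..<n}" for P
  proof -
    have sub: "A P \<subseteq> {S. subspace S \<and> coordinates_on P S}" unfolding A_def by auto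
    show "finite (A P)" by (rule finite_subset[OF sub card_subspaces(1)[OF that]])
    show "card (A P) \<le> q ^ (card P * (n - card P))"
      using card_mono[OF card_subspaces(1)[OF that] sub] card_subspaces(2)[OF that] by (rule order_trans)
  qed
  have bad: "{f \<in> algebras R n. \<not> generates f ?e} \<subseteq> (\<Union>P\<in>Pow {..<n}. \<Union>S\<in>A P. C S)"
  proof
    fix f assume "f \<in> {f \<in> algebras R n. \<not> generates f ?e}"
    then obtain S where f: "f \<in> algebras R n" and S: "S \<subseteq> V" "?e \<in> S" "S \<noteq> V"
      and op: "\<forall>s<q + 1. \<forall>u\<in>S. \<forall>v\<in>S. operation f s u v \<in> S"
      unfolding generates_def by (auto simp only: mem_Collect_eq not_all not_imp)
    note op = op[rule_format]
    have "subspace S"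
      unfolding subspace_def
    proof (intro conjI ballI)
      fix s u v assume "s \<in> carrier R" "u \<in> S" "v \<in> S"
      then show "vadd R n (vscale R n s u) v \<in> S"
        using op[of s u v] by (simp add: less_q operation_def)
    qed (use S in auto)
    moreover from this obtain P where P: "coordinates_on P S" using ex_coordinates_on by auto
    ultimately have "S \<in> A P" using S unfolding A_def by simp
    moreover have "f \<in> C S"
      unfolding C_def closed_under_def using f op[of q] by (simp add: operation_def)
    moreover have "P \<in> Pow {..<n}" using P unfolding coordinates_on_def by simp
    ultimately show "f \<in> (\<Union>P\<in>Pow {..<n}. \<Union>S\<in>A P. C S)" by (intro UN_I)
  qed
  have nonzero: "\<exists>i\<in>P. ?e i \<noteq> \<zero>" if "S \<in> A P" for S P
  proof (rule ccontr)
    assume "\<not> (\<exists>i\<in>P. ?e i \<noteq> \<zero>)"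
    then have "?e i = zero_vec i" if "i \<in> P" for i
      using that coordinates_on_less[of P S i] \<open>S \<in> A P\<close> by (simp add: A_def zero_vec_def)
    then have "?e = zero_vec"
      using that subspace_zero[of S] coordinates_on_eq[of P S ?e zero_vec] by (simp add: A_def)
    then show False using e0 n by (simp add: zero_vec_def)
  qed
  \<comment> \<open>Coordinate 0 is the only nonzero one of the unit vector, so \<open>P\<close>
    must contain it to tell that vector from zero. Thus \<open>card P = 1\<close> forces
    \<open>P = {0}\<close>.\<close>
  have zero_in: "0 \<in> P" if "S \<in> A P" for S P
    using nonzero[OF that] ei coordinates_on_less[of P S] that by (metis (no_types, lifting) A_def gr_zeroI mem_Collect_eq)
  have proper: "P \<noteq> {..<n}" if S: "S \<in> A P" for S P
  proof
    assume P: "P = {..<n}"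
    have SA: "subspace S" "coordinates_on P S" "S \<noteq> V" using S by (simp_all add: A_def)
    have V: "subspace V" unfolding subspace_def using vadd_closed vscale_closed zero_vec_closed by auto
    have dual: "\<exists>b\<in>V \<inter> S. b i = \<one> \<and> (\<forall>j\<in>P - {i}. b j = \<zero>)" if "i \<in> P" for i
      using SA(2) that subspace_in_V[OF SA(1)] unfolding coordinates_on_def by (metis IntI)
    have "coordinates_on P V"
      unfolding coordinates_on_def
    proof (intro conjI ballI impI)
      fix u v assume "u \<in> V" "v \<in> V" "\<forall>i\<in>P. u i = v i"
      then show "u = v" using P by (intro vecs_eqI[of u R n v]) auto
    next
      fix i assume "i \<in> P"
      from dual[OF this] show "\<exists>b\<in>V. b i = \<one> \<and> (\<forall>j\<in>P - {i}. b j = \<zero>)" by auto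
    qed (use P in simp)
    then have "V \<subseteq> S" by (rule subspace_subset[OF V _ SA(1) dual])
    then show False using SA(1,3) unfolding subspace_def by auto
  qed
  \<comment> \<open>For \<open>P = {0}\<close> the unit vector itself is the dual vector, shared by
    all candidates.\<close>
  have card1: "card (A {0}) \<le> 1"
  proof -
    have "S \<subseteq> S'" if "S \<in> A {0}" "S' \<in> A {0}" for S S'
      by (rule subspace_subset[of S "{0}" S']) (use that e0 in \<open>auto simp: A_def\<close>)
    then have "\<forall>S\<in>A {0}. \<forall>S'\<in>A {0}. S = S'" by (intro ballI subset_antisym)
    then show ?thesis using finA[of "{0}"] n by (simp add: card_le_Suc0_iff_eq)
  qed
  have main: "card (\<Union>S\<in>A P. C S) \<le> (if P = {0} then q ^ (n * n * n - (n - 1)) else q ^ (n * n * n - 2 * (n - 2)))"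
    if P: "P \<subseteq> {..<n}" for P
  proof (cases "A P = {}")
    case False
    then obtain S where S: "S \<in> A P" by auto
    define k where "k = card P"
    have finP: "finite P" using P finite_subset by auto
    have "card (\<Union>S\<in>A P. C S) \<le> (\<Sum>S\<in>A P. card (C S))" by (rule card_UN_le[OF finA[OF P]])
    also have "\<dots> \<le> (\<Sum>S\<in>A P. q ^ (n * n * n - k * k * (n - k)))"
      by (intro sum_mono) (auto simp: A_def C_def k_def intro: card_closed_algebras)
    finally have *: "card (\<Union>S\<in>A P. C S) \<le> card (A P) * q ^ (n * n * n - k * k * (n - k))" by simp
    show ?thesis
    proof (cases "P = {0}")
      case True
      then have "k = 1" by (simp add: k_def)
      then have "card (\<Union>S\<in>A P. C S) \<le> card (A P) * q ^ (n * n * n - (n - 1))" using * by simp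
      also have "\<dots> \<le> 1 * q ^ (n * n * n - (n - 1))" using card1 True by (intro mult_right_mono) simp_all
      finally show ?thesis using True by simp
    next
      case False
      have "{0} \<subset> P" using zero_in[OF S] False by auto
      then have "card {0::nat} < card P" using finP by (intro psubset_card_mono)
      then have k2: "2 \<le> k" by (simp add: k_def)
      have "P \<subset> {..<n}" using P proper[OF S] by auto
      then have "card P < card {..<n}" by (intro psubset_card_mono) auto
      then have kn: "k < n" by (simp add: k_def)
      note * 
      also have "card (A P) * q ^ (n * n * n - k * k * (n - k))
          \<le> q ^ (k * (n - k)) * q ^ (n * n * n - k * k * (n - k))"
        using cardA[OF P] by (intro mult_right_mono) (simp_all add: k_def)
      also have "\<dots> = q ^ (k * (n - k) + (n * n * n - k * k * (n - k)))" by (simp add: power_add)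
      also have "\<dots> \<le> q ^ (n * n * n - 2 * (n - 2))"
        using exponent_bound[OF k2 kn] q_ge_2 by (intro power_increasing) linarith+
      finally show ?thesis using False by simp
    qed
  qed simp
  have "card {f \<in> algebras R n. \<not> generates f ?e} \<le> card (\<Union>P\<in>Pow {..<n}. \<Union>S\<in>A P. C S)"
    by (rule card_mono[OF _ bad]) (use finA finite_algebras in \<open>auto simp: C_def\<close>)
  also have "\<dots> \<le> (\<Sum>P\<in>Pow {..<n}. card (\<Union>S\<in>A P. C S))" by (rule card_UN_le) simp
  also have "\<dots> \<le> (\<Sum>P\<in>Pow {..<n}. (if P = {0} then q ^ (n * n * n - (n - 1)) else 0) + q ^ (n * n * n - 2 * (n - 2)))"
  proof (rule sum_mono)
    fix P assume "P \<in> Pow {..<n}"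
    with main[of P] show "card (\<Union>S\<in>A P. C S)
        \<le> (if P = {0} then q ^ (n * n * n - (n - 1)) else 0) + q ^ (n * n * n - 2 * (n - 2))"
      by (auto split: if_splits)
  qed
  also have "\<dots> = q ^ (n * n * n - (n - 1)) + 2 ^ n * q ^ (n * n * n - 2 * (n - 2))"
    using n by (simp add: sum.distrib card_Pow)
  \<comment> \<open>The \<open>2 ^ n\<close> sets cost \<open>q ^ n\<close>, and
    \<open>2 * (n - 2) - n = n - 4\<close>; the first summand is weakened to match. Adding two equal
    terms costs one more factor \<open>q\<close>, which leaves \<open>n - 5\<close>.\<close>
  also have "\<dots> \<le> q ^ (n * n * n - (n - 4)) + q ^ n * q ^ (n * n * n - 2 * (n - 2))"
    using q_ge_2 by (intro add_mono mult_right_mono power_mono power_increasing) auto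
  also have "q ^ n * q ^ (n * n * n - 2 * (n - 2)) = q ^ (n * n * n - (n - 4))"
  proof -
    have "5 * n \<le> n * n" using n by (rule mult_right_mono) simp
    also have "n * n \<le> n * n * n" using n by simp
    finally have "n + (n * n * n - 2 * (n - 2)) = n * n * n - (n - 4)" using n by linarith
    then show ?thesis by (simp flip: power_add)
  qed
  also have "q ^ (n * n * n - (n - 4)) + q ^ (n * n * n - (n - 4)) \<le> q * q ^ (n * n * n - (n - 4))"
    unfolding mult_2[symmetric] by (rule mult_right_mono[OF q_ge_2]) simp
  also have "\<dots> = q ^ Suc (n * n * n - (n - 4))" by simp
  finally have "card {f \<in> algebras R n. \<not> generates f ?e} * q ^ (n - 5)
      \<le> q ^ Suc (n * n * n - (n - 4)) * q ^ (n - 5)" by (intro mult_right_mono) simp_all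
  also have "\<dots> = q ^ (Suc (n * n * n - (n - 4)) + (n - 5))" by (simp only: power_add)
  also have "Suc (n * n * n - (n - 4)) + (n - 5) = n * n * n"
  proof -
    have "1 * n \<le> (n * n) * n" using n by (intro mult_right_mono) (simp_all add: Suc_le_eq)
    then show ?thesis using n by linarith
  qed
  finally show ?thesis .
qed

end

section \<open>Time and failure probability\<close>

text \<open>Acceptance quantifies over arbitrary runs; determinism identifies them with the run
  provided by \<open>wp\<close>.\<close>

lemma wp_halts_accepts:
  assumes "wp B P (\<lambda>r m. r 0 \<noteq> 0 \<longleftrightarrow> Q) r m"
  shows "halts_within P (r, m) (time_bound B P)" "accepts P (r, m) \<longleftrightarrow> Q"
proof -
  obtain t r' m' where *: "exec P (r, m) t (r', m')" "t \<le> time_bound B P" "r' 0 \<noteq> 0 \<longleftrightarrow> Q"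
    using assms unfolding wp_def by blast
  show "halts_within P (r, m) (time_bound B P)"
    using *(1,2) unfolding halts_within_def by blast
  show "accepts P (r, m) \<longleftrightarrow> Q"
  proof
    assume "accepts P (r, m)"
    then obtain u \<tau> where "exec P (r, m) u \<tau>" "fst \<tau> 0 \<noteq> 0" unfolding accepts_def by blast
    with exec_deterministic[OF *(1)] *(3) show Q by (metis fst_conv)
  next
    assume Q
    with * show "accepts P (r, m)" unfolding accepts_def by (metis fst_conv)
  qed
qed

context coordinate_space
begin

lemma isomorphism_test_input:
  assumes "f \<in> algebras R n" "g \<in> algebras R n"
  shows "halts_within isomorphism_test (input R q n f g) (time_bound size_bound isomorphism_test)"
    and "accepts isomorphism_test (input R q n f g) \<longleftrightarrow>
      (\<exists>x<N. \<exists>v<N. bijection_graph N (generated (q + 1) (code_operation g) (code_operation f) (x, v)))"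
  unfolding input_def
  by (rule wp_halts_accepts[OF wp_isomorphism_test[OF assms]]; simp)+

lemma accepts_iff_isomorphic:
  assumes "f \<in> algebras R n" "g \<in> algebras R n" "generates f w" "w \<in> V"
  shows "accepts isomorphism_test (input R q n f g) \<longleftrightarrow> alg_isomorphic R n f g"
  unfolding isomorphism_test_input(2)[OF assms(1,2)]
  using isomorphic_bijection_graph[OF assms(1,2,4,3)] bijection_graph_isomorphic[OF assms(1,2)] by metis

text \<open>Since \<open>q + 2 \<le> q * q\<close> for \<open>q \<ge> 2\<close>, the base of the
  polynomial time bound is at most a pure power of \<open>q\<close>.\<close>

lemma size_bound_less: "size_bound + 1 \<le> q ^ (2 * n + 2)"
proof -
  have "0 < N * N" using N_pos by (intro mult_pos_pos)
  then have "size_bound + 1 \<le> (q + 1) * (N * N) + N * N" unfolding mult.assoc by linarith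
  also have "\<dots> = (q + 2) * (N * N)" by (simp add: algebra_simps)
  also have "\<dots> \<le> (q * q) * (N * N)"
  proof (rule mult_right_mono)
    have "q + 2 \<le> 2 * q" using q_ge_2 by simp
    also have "2 * q \<le> q * q" by (rule mult_right_mono[OF q_ge_2]) simp
    finally show "q + 2 \<le> q * q" .
  qed simp
  also have "\<dots> = q ^ (2 * n + 2)" 
    unfolding mult_2[of n] power_add power2_eq_square by (rule mult.commute)
  finally show ?thesis .
qed

lemma failure_probability:
  "real (card {f \<in> algebras R n. \<exists>g\<in>algebras R n.
      \<not> (accepts isomorphism_test (input R q n f g) \<longleftrightarrow> alg_isomorphic R n f g)})
    / real (card (algebras R n)) \<le> 1 / real q ^ (n - 5)"
proof -
  let ?F = "{f \<in> algebras R n. \<exists>g\<in>algebras R n.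
      \<not> (accepts isomorphism_test (input R q n f g) \<longleftrightarrow> alg_isomorphic R n f g)}"
  have "card ?F * q ^ (n - 5) \<le> q ^ (n * n * n)"
  proof (cases "n \<ge> 5")
    case True
    have "?F \<subseteq> {f \<in> algebras R n. \<not> generates f (unit_vec R n 0)}"
      using accepts_iff_isomorphic unit_vec_closed by auto
    then have "card ?F \<le> card {f \<in> algebras R n. \<not> generates f (unit_vec R n 0)}"
      using finite_algebras by (intro card_mono) auto
    then have "card ?F * q ^ (n - 5) \<le> card {f \<in> algebras R n. \<not> generates f (unit_vec R n 0)} * q ^ (n - 5)"
      by (rule mult_right_mono) simp
    also have "\<dots> \<le> q ^ (n * n * n)" by (rule card_not_generated_from[OF True])
    finally show ?thesis .
  next
    case False
    \<comment> \<open>Below 5 the truncated exponent \<open>n - 5\<close> is 0, so the claim is only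
      that a fraction is at most 1.\<close>
    have "card ?F \<le> card (algebras R n)" by (rule card_mono[OF finite_algebras]) auto
    with False show ?thesis by (simp add: card_algebras)
  qed
  then have "real (card ?F * q ^ (n - 5)) \<le> real (q ^ (n * n * n))" by (rule of_nat_mono)
  then have "real (card ?F) * real q ^ (n - 5) \<le> real q ^ (n * n * n)"
    by (simp only: of_nat_mult of_nat_power)
  moreover have "0 < real q" using q_ge_2 by simp
  ultimately show ?thesis by (simp add: card_algebras divide_le_eq pos_le_divide_eq)
qed

end

theorem theorem3p8:
  shows "\<exists>(P :: prog) (t :: nat \<Rightarrow> nat) (s :: nat \<Rightarrow> nat).
    (\<lambda>n. real (t n)) \<in> O(\<lambda>n. real n) \<and>
    (\<lambda>n. real (s n)) \<in> \<Omega>(\<lambda>n. real n) \<and>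
    (\<forall>q n R. finite_field R q \<longrightarrow>
      (\<forall>f\<in>algebras R n. \<forall>g\<in>algebras R n. halts_within P (input R q n f g) (q ^ t n)) \<and>
      real (card {f \<in> algebras R n. \<exists>g\<in>algebras R n.
          \<not> (accepts P (input R q n f g) \<longleftrightarrow> alg_isomorphic R n f g)})
        / real (card (algebras R n))
        \<le> 1 / real q ^ s n)"
proof -
  obtain C D where time: "\<And>B. time_bound B isomorphism_test \<le> C * (B + 1) ^ D"
    using time_bound_polynomial[of isomorphism_test] by blast
  \<comment> \<open>\<open>C \<le> q ^ C\<close> absorbs the constant factor; the second summand
    comes from raising \<open>q ^ (2 * n + 2)\<close> to the power \<open>D\<close>.\<close>
  define t where "t n = C + (2 * n + 2) * D" for n
  have t: "(\<lambda>n. real (t n)) \<in> O(\<lambda>n. real n)"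
  proof (rule bigoI[where c = "real (C + 4 * D)"])
    have "t n \<le> (C + 4 * D) * n" if "n \<ge> 1" for n
    proof -
      have "C + (2 * n + 2) * D \<le> C * n + (4 * n) * D"
        using that by (intro add_mono mult_right_mono) auto
      then show ?thesis by (simp add: t_def algebra_simps)
    qed
    then have "norm (real (t n)) \<le> real (C + 4 * D) * norm (real n)" if "n \<ge> 1" for n
      using that by (simp only: norm_of_nat of_nat_mult[symmetric] of_nat_le_iff)
    then show "\<forall>\<^sub>F n in at_top. norm (real (t n)) \<le> real (C + 4 * D) * norm (real n)"
      using eventually_ge_at_top[of 1] by (rule eventually_mono[rotated])
  qed
  have s: "(\<lambda>n. real (n - 5)) \<in> \<Omega>(\<lambda>n. real n)"
  proof (rule landau_omega.bigI[where c = "1/2"])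
    have "norm (real (n - 5)) \<ge> 1/2 * norm (real n)" if "n \<ge> 10" for n
      using that by (simp add: of_nat_diff)
    then show "\<forall>\<^sub>F n in at_top. norm (real (n - 5)) \<ge> 1/2 * norm (real n)"
      using eventually_ge_at_top[of 10] by (rule eventually_mono[rotated])
  qed simp
  have halts: "halts_within isomorphism_test (input R q n f g) (q ^ t n)"
    if "finite_field R q" "f \<in> algebras R n" "g \<in> algebras R n" for R q n f g
  proof -
    interpret coordinate_space R q n by unfold_locales (rule that(1))
    have "C \<le> 2 ^ C" by (rule less_imp_le[OF less_exp])
    also have "\<dots> \<le> q ^ C" by (rule power_mono[OF q_ge_2]) simp
    finally have "C * (size_bound + 1) ^ D \<le> q ^ C * (q ^ (2 * n + 2)) ^ D"
      using size_bound_less by (intro mult_mono power_mono) auto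
    also have "\<dots> = q ^ t n" by (simp only: t_def power_add power_mult)
    finally have "time_bound size_bound isomorphism_test \<le> q ^ t n" using time order_trans by blast
    with isomorphism_test_input(1)[OF that(2,3)] show ?thesis
      unfolding halts_within_def by (meson order_trans)
  qed
  have failure: "real (card {f \<in> algebras R n. \<exists>g\<in>algebras R n.
        \<not> (accepts isomorphism_test (input R q n f g) \<longleftrightarrow> alg_isomorphic R n f g)})
      / real (card (algebras R n)) \<le> 1 / real q ^ (n - 5)" if "finite_field R q" for R q n
    by (rule coordinate_space.failure_probability) (rule coordinate_space.intro[OF that])
  show ?thesis
    by (intro exI[of _ isomorphism_test] exI[of _ t] exI[of _ "\<lambda>n. n - 5"] conjI allI impI ballI
        t s halts failure)
qed

end
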